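(* Let $k,r$ be positive integers and $h=4$, such that $\ell=\frac{k+4}{r}$ is an integer. Let $m$ be the smallest integer such that $3\mid(m-1)$ and $\ell\le 2^{r(m-1)}$. Then there exists a maximally recoverable local $(k,r,4)$-code over the field $\mathbb{F}_{2^t}$, where $t=r\left(2m+\frac{m-1}{3}\right)$.
   Context: For positive integers $k,r,h$ with $r\mid(k+h)$, a local $(k,r,h)$-code over a finite field $\mathbb{F}$ is a linear systematic code of dimension $k$ and length $k+h+\frac{k+h}{r}$ consisting of $k$ data symbols, $h$ heavy parity symbols (each a fixed $\mathbb{F}$-linear combination of all data symbols), and, after partitioning the $k+h$ data and heavy parity symbols into $\frac{k+h}{r}$ groups of size $r$, one local parity per group equal to the sum (XOR) of the group's symbols. A local group is such a group together with its local parity. The code is maximally recoverable if for every set $E$ of coordinates containing exactly one coordinate from each local group, puncturing the code in $E$ yields a maximum distance separable $[k+h,k]$ code (minimum distance $h+1$). *)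

theory Defs
  imports Main
begin

(* Coordinates of a local (k,r,h)-code of length n = k+h+(k+h)/r:
   0..k-1 data symbols, k..k+h-1 heavy parities, k+h..k+h+l-1 local parities
   (l = (k+h) div r).  Vectors are functions nat => 'a (zero outside the range).
   H :: nat => nat => 'a gives the heavy parity coefficients: parity j = sum_i H j i * x i.
   g :: nat => nat assigns each of the k+h data/heavy symbols to its local group. *)

definition sys_part :: "nat \<Rightarrow> nat \<Rightarrow> (nat \<Rightarrow> nat \<Rightarrow> 'a::field) \<Rightarrow> (nat \<Rightarrow> 'a) \<Rightarrow> nat \<Rightarrow> 'a" where
  "sys_part k h H x i =
     (if i < k then x i
      else if i < k + h then (\<Sum>j<k. H (i - k) j * x j)
      else 0)"

definition local_encode ::
  "nat \<Rightarrow> nat \<Rightarrow> nat \<Rightarrow> (nat \<Rightarrow> nat \<Rightarrow> 'a::field) \<Rightarrow> (nat \<Rightarrow> nat) \<Rightarrow> (nat \<Rightarrow> 'a) \<Rightarrow> nat \<Rightarrow> 'a" where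
  "local_encode k r h H g x =
     (\<lambda>i. if i < k + h then sys_part k h H x i
          else if i < k + h + (k + h) div r then
            (\<Sum>i'\<in>{i'. i' < k + h \<and> g i' = i - (k + h)}. sys_part k h H x i')
          else 0)"

definition data_vectors :: "nat \<Rightarrow> (nat \<Rightarrow> 'a::zero) set" where
  "data_vectors k = {x. \<forall>i\<ge>k. x i = 0}"

definition local_code ::
  "nat \<Rightarrow> nat \<Rightarrow> nat \<Rightarrow> (nat \<Rightarrow> nat \<Rightarrow> 'a::field) \<Rightarrow> (nat \<Rightarrow> nat) \<Rightarrow> (nat \<Rightarrow> 'a) set" where
  "local_code k r h H g = local_encode k r h H g ` data_vectors k"

definition code_length :: "nat \<Rightarrow> nat \<Rightarrow> nat \<Rightarrow> nat" where
  "code_length k r h = k + h + (k + h) div r"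

definition valid_grouping :: "nat \<Rightarrow> nat \<Rightarrow> nat \<Rightarrow> (nat \<Rightarrow> nat) \<Rightarrow> bool" where
  "valid_grouping k r h g \<longleftrightarrow>
     (\<forall>i<k + h. g i < (k + h) div r) \<and>
     (\<forall>j<(k + h) div r. card {i. i < k + h \<and> g i = j} = r)"

definition local_group :: "nat \<Rightarrow> nat \<Rightarrow> (nat \<Rightarrow> nat) \<Rightarrow> nat \<Rightarrow> nat set" where
  "local_group k h g j = {i. i < k + h \<and> g i = j} \<union> {k + h + j}"

definition restrict_coords :: "nat set \<Rightarrow> (nat \<Rightarrow> 'a::zero) set \<Rightarrow> (nat \<Rightarrow> 'a) set" where
  "restrict_coords S C = (\<lambda>c. \<lambda>i. if i \<in> S then c i else 0) ` C"

definition hamming_weight :: "nat set \<Rightarrow> (nat \<Rightarrow> 'a::zero) \<Rightarrow> nat" where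
  "hamming_weight S c = card {i \<in> S. c i \<noteq> 0}"

definition min_distance :: "nat set \<Rightarrow> (nat \<Rightarrow> 'a::zero) set \<Rightarrow> nat" where
  "min_distance S C = Min {hamming_weight S c | c. c \<in> C \<and> c \<noteq> (\<lambda>_. 0)}"

(* C, a linear code with coordinate set S (|S| = n), is an MDS [n,kk] code:
   dimension kk (i.e. q^kk codewords) and minimum distance n - kk + 1 *)
definition is_mds_code :: "nat set \<Rightarrow> nat \<Rightarrow> (nat \<Rightarrow> 'a::{finite,field}) set \<Rightarrow> bool" where
  "is_mds_code S kk C \<longleftrightarrow>
     card C = card (UNIV :: 'a set) ^ kk \<and> min_distance S C = card S - kk + 1"

definition maximally_recoverable ::
  "nat \<Rightarrow> nat \<Rightarrow> nat \<Rightarrow> (nat \<Rightarrow> nat \<Rightarrow> 'a::{finite,field}) \<Rightarrow> (nat \<Rightarrow> nat) \<Rightarrow> bool" where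
  "maximally_recoverable k r h H g \<longleftrightarrow>
     (\<forall>E. E \<subseteq> {..<code_length k r h} \<and>
          (\<forall>j<(k + h) div r. card (E \<inter> local_group k h g j) = 1) \<longrightarrow>
          is_mds_code ({..<code_length k r h} - E) k
            (restrict_coords ({..<code_length k r h} - E) (local_code k r h H g)))"

end

theory Submission
  imports Defs "HOL-Algebra.Algebraic_Closure_Type" "HOL-Library.Function_Algebras"
    "HOL-Library.Product_Plus" "HOL-Library.Z2" "HOL-Number_Theory.Residues"
    "Jordan_Normal_Form.Determinant"
begin

text \<open>Attach a point \<open>\<alpha> i\<close> of the field to every coordinate, \<open>0\<close> to the local parities, and impose the
  heavy checks \<open>\<Sum>i. \<alpha> i ^ (2 ^ d) * c i = 0\<close> for \<open>d < 4\<close>. A square Moore matrix is invertible iff its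
  generators are independent over the field with two elements, so maximal recoverability reduces
  to binary independence of any four differences of points inside the local groups.

  Write \<open>q = 2 ^ r\<close> and \<open>m = 3 * s + 1\<close>, and let \<open>\<sigma>\<close> be the Frobenius map of order 3 of the field with
  \<open>q ^ (3 * s)\<close> elements over the one with \<open>q ^ s\<close> elements. Distinct elements \<open>x\<close> of the big field are
  assigned to the groups; any four of the vectors \<open>(1, x, x * \<sigma> x, x * \<sigma> x * \<sigma> (\<sigma> x))\<close> are independent
  over the field with \<open>q\<close> elements. Indeed, a translation moves one of the four points to \<open>0\<close>, inverting
  the other three lowers the degree of the constraints to 2, and a second translation leaves two
  points. The points of a group are the multiples of its vector by a binary basis of the field with
  \<open>q\<close> elements. These vectors live in a binary space of dimension \<open>r * (1 + 7 * s) \<le> t\<close>, which embeds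
  additively into the field with \<open>2 ^ t\<close> elements.\<close>

section \<open>Linear algebra\<close>

lemma double_CHAR_2: "CHAR('a::ring_1) = 2 \<Longrightarrow> x + x = (0 :: 'a)"
  using minus_CHAR_2[of x x] by simp

context vector_space
begin

lemma card_span:
  assumes finite_scalars: "finite (UNIV :: 'a set)" and "finite B" and indep: "independent B"
  shows "card (span B) = card (UNIV :: 'a set) ^ card B"
proof -
  have "inj_on (\<lambda>u. \<Sum>v\<in>B. u v *s v) (B \<rightarrow>\<^sub>E UNIV)"
  proof (rule inj_onI)
    fix u w
    assume extensional: "u \<in> B \<rightarrow>\<^sub>E UNIV" "w \<in> B \<rightarrow>\<^sub>E UNIV" and "(\<Sum>v\<in>B. u v *s v) = (\<Sum>v\<in>B. w v *s v)"
    then have "(\<Sum>v\<in>B. (u v - w v) *s v) = 0"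
      by (simp add: scale_left_diff_distrib sum_subtractf)
    then have "u v - w v = 0" if "v \<in> B" for v
      by (rule independentD[OF indep \<open>finite B\<close> order.refl _ that, where u = "\<lambda>v. u v - w v"])
    then show "u = w" using extensional by (intro PiE_ext) auto
  qed
  moreover have "(\<lambda>u. \<Sum>v\<in>B. u v *s v) ` (B \<rightarrow>\<^sub>E UNIV) = span B"
  proof
    show "span B \<subseteq> (\<lambda>u. \<Sum>v\<in>B. u v *s v) ` (B \<rightarrow>\<^sub>E UNIV)"
    proof
      fix x assume "x \<in> span B"
      then obtain u where "x = (\<Sum>v\<in>B. u v *s v)" using span_finite[OF \<open>finite B\<close>] by auto
      then show "x \<in> (\<lambda>u. \<Sum>v\<in>B. u v *s v) ` (B \<rightarrow>\<^sub>E UNIV)"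
        by (intro image_eqI[of _ _ "restrict u B"]) auto
    qed
  qed (auto simp: span_finite[OF \<open>finite B\<close>])
  ultimately have "card (span B) = card (B \<rightarrow>\<^sub>E (UNIV :: 'a set))"
    using card_image by fastforce
  then show ?thesis using \<open>finite B\<close> by (simp add: card_PiE)
qed

lemma obtain_finite_basis:
  assumes "finite (UNIV :: 'a set)" "subspace V" "finite V"
  obtains B where "finite B" "independent B" "span B = V" "card V = card (UNIV :: 'a set) ^ card B"
proof -
  obtain B where basis: "B \<subseteq> V" "independent B" "V \<subseteq> span B" by (rule basis_exists)
  then have "span B = V" using span_minimal assms(2) by blast
  moreover have "finite B" using basis(1) assms(3) finite_subset by blast
  ultimately show thesis using that basis(2) card_span[OF assms(1)] by metis
qed

end

lemma (in vector_space_pair) ex_linear_embedding: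
  assumes scalars: "finite (UNIV :: 'a set)" and source: "vs1.subspace V" "finite V"
    and target: "vs2.subspace W" "finite W" and card_le: "card V \<le> card W"
  shows "\<exists>f. Vector_Spaces.linear s1 s2 f \<and> inj_on f V"
proof -
  obtain B where source_basis: "finite B" "vs1.independent B" "vs1.span B = V"
      "card V = card (UNIV :: 'a set) ^ card B"
    using vs1.obtain_finite_basis[OF scalars source] .
  obtain C
    where target_basis: "finite C" "vs2.independent C" "card W = card (UNIV :: 'a set) ^ card C"
    using vs2.obtain_finite_basis[OF scalars target] by metis
  have "1 < card (UNIV :: 'a set)"
    using card_mono[OF scalars, of "{0, 1}"] by simp
  then have "card B \<le> card C" using card_le source_basis(4) target_basis(3) by simp
  then obtain g where injection: "g ` B \<subseteq> C" "inj_on g B"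
    using card_le_inj[OF source_basis(1) target_basis(1)] by blast
  obtain f where extension: "Vector_Spaces.linear s1 s2 f" "\<And>x. x \<in> B \<Longrightarrow> f x = g x"
    using linear_independent_extend[OF source_basis(2), of g] by blast
  have "f ` B = g ` B" "inj_on f B" using extension(2) injection(2) by (auto cong: inj_on_cong)
  moreover have "vs2.independent (g ` B)"
    using target_basis(2) injection(1) vs2.independent_mono by blast
  ultimately have "inj_on f V"
    using linear_inj_on_span_independent_image[OF extension(1), of B] source_basis(3) by simp
  then show ?thesis using extension(1) by blast
qed

lemma square_system_solvable:
  fixes A :: "nat \<Rightarrow> nat \<Rightarrow> 'a::field"
  assumes kernel: "\<And>y. (\<And>i. i < n \<Longrightarrow> (\<Sum>j<n. A i j * y j) = 0) \<Longrightarrow> \<forall>j<n. y j = 0"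
  shows "\<exists>y. \<forall>i<n. (\<Sum>j<n. A i j * y j) = b i"
proof -
  define M where "M = mat n n (\<lambda>(i, j). A i j)"
  have carrier: "M \<in> carrier_mat n n" by (simp add: M_def)
  have M_vec: "(M *\<^sub>v v) $ i = (\<Sum>j<n. A i j * v $ j)" if "v \<in> carrier_vec n" "i < n" for v i
    using that by (simp add: M_def scalar_prod_def atLeast0LessThan)
  have "det M \<noteq> 0"
  proof
    assume "det M = 0"
    then obtain v where kernel_vector: "v \<in> carrier_vec n" "v \<noteq> 0\<^sub>v n" "M *\<^sub>v v = 0\<^sub>v n"
      using det_0_iff_vec_prod_zero_field[OF carrier] by blast
    have "(\<Sum>j<n. A i j * v $ j) = 0" if "i < n" for i
      using M_vec[OF kernel_vector(1) that] kernel_vector(3) that by simp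
    then have "\<forall>j<n. v $ j = 0" by (rule kernel)
    then have "v = 0\<^sub>v n" using kernel_vector(1) by (intro eq_vecI) auto
    then show False using kernel_vector(2) by contradiction
  qed
  then obtain M' where inverse: "M' \<in> carrier_mat n n" "M * M' = 1\<^sub>m n"
    using det_non_zero_imp_unit[OF carrier, of "()"] unfolding Units_def ring_mat_def by auto
  define y where "y = M' *\<^sub>v vec n b"
  have "M *\<^sub>v y = vec n b"
    unfolding y_def using assoc_mult_mat_vec[OF carrier inverse(1), of "vec n b"] inverse(2) by simp
  moreover have "y \<in> carrier_vec n" using inverse by (simp add: y_def)
  ultimately show ?thesis using M_vec[of y] by (intro exI[of _ "\<lambda>j. y $ j"]) simp
qed

subsection \<open>Groups of exponent 2\<close>

definition binary_independent :: "('i \<Rightarrow> 'b::comm_monoid_add) \<Rightarrow> 'i set \<Rightarrow> bool" where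
  "binary_independent f J \<longleftrightarrow> (\<forall>I\<subseteq>J. finite I \<longrightarrow> I \<noteq> {} \<longrightarrow> sum f I \<noteq> 0)"

lemma binary_independentD:
  "binary_independent f J \<Longrightarrow> I \<subseteq> J \<Longrightarrow> finite I \<Longrightarrow> I \<noteq> {} \<Longrightarrow> sum f I \<noteq> 0"
  by (auto simp: binary_independent_def)

lemma binary_independent_cong:
  assumes "\<And>i. i \<in> J \<Longrightarrow> f i = f' i"
  shows "binary_independent f J \<longleftrightarrow> binary_independent f' J"
proof -
  have "sum f I = sum f' I" if "I \<subseteq> J" for I using assms that by (intro sum.cong) auto
  then show ?thesis by (simp add: binary_independent_def)
qed

lemma binary_independent_reindex:
  assumes "binary_independent f K" "inj_on h J" "h ` J \<subseteq> K"
  shows "binary_independent (\<lambda>i. f (h i)) J"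
  unfolding binary_independent_def
proof (intro allI impI)
  fix I assume subset: "I \<subseteq> J" "finite I" "I \<noteq> {}"
  then have "(\<Sum>i\<in>I. f (h i)) = sum f (h ` I)"
    using inj_on_subset[OF assms(2)] by (simp add: sum.reindex)
  also have "\<dots> \<noteq> 0" using subset assms(3) by (intro binary_independentD[OF assms(1)]) auto
  finally show "(\<Sum>i\<in>I. f (h i)) \<noteq> 0" .
qed

lemma binary_independent_differences:
  fixes f :: "'i \<Rightarrow> 'b::ab_group_add"
  assumes char2: "\<And>x::'b. x + x = 0" and indep: "binary_independent f A" and base: "f z = 0"
    and subset: "finite I" "I \<noteq> {}" "I \<subseteq> insert z A" and center: "e \<in> insert z A" "e \<notin> I"
  shows "(\<Sum>i\<in>I. f i - f e) \<noteq> 0"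
proof -
  have minus: "x - y = x + y" for x y :: 'b
    using char2 by (metis add_diff_cancel_right' add.assoc add_0_right)
  \<comment> \<open>Modulo 2 the difference sum is a sum over a set of even size, which is not contained in \<open>{z}\<close>.\<close>
  define T where "T = (if even (card I) then I else insert e I)"
  have const: "(\<Sum>i\<in>I. f e) = (if even (card I) then 0 else f e)"
    using \<open>finite I\<close> by (induction I rule: finite_induct) (auto simp: char2)
  have "(\<Sum>i\<in>I. f i - f e) = sum f T"
    using subset(1) center(2) by (simp add: minus sum.distrib const T_def add.commute)
  also have "\<dots> = sum f (T - {z})"
    using subset(1) base by (intro sum.mono_neutral_right) (auto simp: T_def)
  also have "\<dots> \<noteq> 0"
  proof (rule binary_independentD[OF indep])
    show "T - {z} \<subseteq> A" "finite (T - {z})" using subset center(1) by (auto simp: T_def)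
    have "even (card T)" "T \<noteq> {}" using subset(1,2) center(2) by (auto simp: T_def)
    then have "T \<noteq> {z}" by auto
    then show "T - {z} \<noteq> {}" using \<open>T \<noteq> {}\<close> by blast
  qed
  finally show ?thesis .
qed

definition bit_scale :: "bit \<Rightarrow> 'b::ab_group_add \<Rightarrow> 'b" where
  "bit_scale c x = (if c = 0 then 0 else x)"

lemma vector_space_bit_scale:
  assumes "\<And>x::'b::ab_group_add. x + x = 0"
  shows "vector_space (bit_scale :: bit \<Rightarrow> 'b \<Rightarrow> 'b)"
  by unfold_locales (auto simp: bit_scale_def assms)

lemma card_UNIV_bit: "card (UNIV :: bit set) = 2"
proof -
  have "(UNIV :: bit set) = {0, 1}" by auto
  then show ?thesis by (metis card_2_iff zero_neq_one)
qed

lemma ex_binary_independent: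
  fixes V :: "'b::ab_group_add set"
  assumes char2: "\<And>x::'b. x + x = 0"
    and group: "0 \<in> V" "\<And>x y. x \<in> V \<Longrightarrow> y \<in> V \<Longrightarrow> x + y \<in> V" "card V = 2 ^ n"
  shows "\<exists>b :: nat \<Rightarrow> 'b. b ` {..<n} \<subseteq> V \<and> binary_independent b {..<n}"
proof -
  interpret vector_space "bit_scale :: bit \<Rightarrow> 'b \<Rightarrow> 'b" using char2 by (rule vector_space_bit_scale)
  have "subspace V" using group by (auto simp: subspace_def bit_scale_def)
  moreover have "finite V" using group(3) by (intro card_ge_0_finite) simp
  ultimately obtain B where basis: "finite B" "independent B" "span B = V" "card V = 2 ^ card B"
    using obtain_finite_basis card_UNIV_bit by (metis card.infinite zero_neq_numeral)
  have "card B = n" using basis(4) group(3) by simp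
  then obtain b where enumeration: "bij_betw b {..<n} B"
    using basis(1) ex_bij_betw_nat_finite[of B] by (auto simp: atLeast0LessThan)
  have "binary_independent (\<lambda>x. x) B"
    unfolding binary_independent_def
  proof (intro allI impI notI)
    fix I assume relation: "I \<subseteq> B" "finite I" "I \<noteq> {}" "\<Sum>I = 0"
    then show False using independentD[OF basis(2), of I "\<lambda>_. 1"] by (auto simp: bit_scale_def)
  qed
  then have "binary_independent b {..<n}"
    using binary_independent_reindex[of "\<lambda>x. x" B b] enumeration by (auto simp: bij_betw_def)
  moreover have "b ` {..<n} \<subseteq> V"
    using enumeration span_superset[of B] basis(3) by (simp add: bij_betw_def)
  ultimately show ?thesis by blast
qed

lemma ex_additive_embedding:
  fixes V :: "'b::ab_group_add set"
  assumes char2: "\<And>x::'b. x + x = 0" "\<And>x::'c. x + x = 0"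
    and group: "finite V" "0 \<in> V" "\<And>x y. x \<in> V \<Longrightarrow> y \<in> V \<Longrightarrow> x + y \<in> V"
    and card_le: "card V \<le> card (UNIV :: 'c::{finite,ab_group_add} set)"
  shows "\<exists>\<phi> :: 'b \<Rightarrow> 'c. additive \<phi> \<and> inj_on \<phi> V"
proof -
  interpret vector_space_pair "bit_scale :: bit \<Rightarrow> 'b \<Rightarrow> 'b" "bit_scale :: bit \<Rightarrow> 'c \<Rightarrow> 'c"
    unfolding vector_space_pair_def using char2 by (auto intro: vector_space_bit_scale)
  have "vs1.subspace V" using group by (auto simp: vs1.subspace_def bit_scale_def)
  moreover have "finite (UNIV :: bit set)" using card_UNIV_bit by (intro card_ge_0_finite) simp
  ultimately obtain \<phi> :: "'b \<Rightarrow> 'c" where "Vector_Spaces.linear bit_scale bit_scale \<phi>" "inj_on \<phi> V"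
    using ex_linear_embedding[of V UNIV] group(1) card_le by auto
  then show ?thesis
    by (intro exI[of _ \<phi>]) (simp add: additive_def linear_add)
qed

lemma binary_independent_additive_image:
  assumes "additive \<phi>" and inj: "inj_on \<phi> V" and group: "0 \<in> V" "\<And>x y. x \<in> V \<Longrightarrow> y \<in> V \<Longrightarrow> x + y \<in> V"
    and family: "f ` J \<subseteq> V" "binary_independent f J"
  shows "binary_independent (\<lambda>i. \<phi> (f i)) J"
  unfolding binary_independent_def
proof (intro allI impI notI)
  interpret additive \<phi> by fact
  fix I assume relation: "I \<subseteq> J" "finite I" "I \<noteq> {}" "(\<Sum>i\<in>I. \<phi> (f i)) = 0"
  have "sum f I \<in> V"
    using \<open>finite I\<close> \<open>I \<subseteq> J\<close> by (induction I rule: finite_induct) (use group family(1) in auto)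
  moreover have "\<phi> (sum f I) = \<phi> 0" using relation(4) by (simp add: sum zero)
  ultimately have "sum f I = 0" using inj group(1) by (simp add: inj_on_eq_iff)
  then show False using binary_independentD[OF family(2)] relation by blast
qed

section \<open>Finite subfields of an algebraically closed field\<close>

lemma order_le_1_if_pderiv_nonzero:
  fixes p :: "'a::idom poly"
  assumes "poly (pderiv p) x \<noteq> 0"
  shows "Polynomial.order x p \<le> 1"
proof (rule ccontr)
  assume "\<not> Polynomial.order x p \<le> 1"
  then have "[:- x, 1:] ^ 2 dvd p" by (subst order_divides) simp
  then obtain q where "p = [:- x, 1:] ^ 2 * q" by (rule dvdE)
  then have "p = [:- x, 1:] * ([:- x, 1:] * q)" by (simp only: power2_eq_square mult.assoc)
  then have "poly (pderiv p) x = 0" by (simp only: pderiv_mult poly_add poly_mult) simp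
  then show False using assms by contradiction
qed

lemma size_proots_eq_degree:
  fixes p :: "'a::alg_closed_field poly"
  assumes "p \<noteq> 0"
  shows "size (proots p) = degree p"
proof -
  obtain A where factorization: "size A = degree p" "p = smult (lead_coeff p) (\<Prod>x\<in>#A. [:- x, 1:])"
    using alg_closed_imp_factorization[OF assms] by blast
  have "(\<Prod>x\<in>#B. [:- x, 1:]) \<noteq> (0 :: 'a poly)" for B by (auto simp: prod_mset_zero_iff)
  then have "proots (\<Prod>x\<in>#A. [:- x, 1:]) = A"
    by (induction A) (simp_all add: proots_mult del: mult_pCons_left)
  then have "proots p = A" using factorization(2) assms by (metis leading_coeff_0_iff proots_smult)
  then show ?thesis using factorization(1) by simp
qed

lemma card_roots_separable:
  fixes p :: "'a::alg_closed_field poly"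
  assumes "p \<noteq> 0" and separable: "\<And>x. poly p x = 0 \<Longrightarrow> poly (pderiv p) x \<noteq> 0"
  shows "card {x. poly p x = 0} = degree p"
proof -
  have "count (proots p) x = 1" if "poly p x = 0" for x
    using order_le_1_if_pderiv_nonzero[OF separable[OF that]] order_root[of p x] assms(1) that
    by (simp add: le_antisym)
  then have "size (proots p) = (\<Sum>x | poly p x = 0. 1)"
    using assms(1) by (simp add: size_multiset_overloaded_eq)
  then show ?thesis using size_proots_eq_degree[OF assms(1)] by simp
qed

text \<open>For \<open>n = 0\<close> the equation is vacuous; the second condition makes the order \<open>CHAR('c) ^ n\<close> in this
  case, too.\<close>

definition galois_field :: "nat \<Rightarrow> 'c::field set" where
  "galois_field n = {x. x ^ (CHAR('c) ^ n) = x \<and> (n = 0 \<longrightarrow> x = 0)}"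

lemma card_galois_field:
  assumes "prime CHAR('c::alg_closed_field)"
  shows "card (galois_field n :: 'c set) = CHAR('c) ^ n"
proof (cases "n = 0")
  case True
  then have "galois_field n = {0 :: 'c}" by (auto simp: galois_field_def)
  then show ?thesis using True by simp
next
  case False
  define q where "q = CHAR('c) ^ n"
  have "1 < q" unfolding q_def using assms False by (intro one_less_power prime_gt_1_nat) auto
  define p :: "'c poly" where "p = monom 1 q - monom 1 1"
  have "degree p = q"
    unfolding p_def diff_conv_add_uminus using \<open>1 < q\<close>
    by (subst degree_add_eq_left) (simp_all add: degree_monom_eq)
  then have "p \<noteq> 0" using \<open>1 < q\<close> by auto
  have "of_nat q = (0 :: 'c)" using False by (simp add: q_def)
  then have "pderiv p = -1" by (simp add: p_def pderiv_diff pderiv_monom)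
  then have "card {x. poly p x = 0} = q"
    using card_roots_separable[OF \<open>p \<noteq> 0\<close>] \<open>degree p = q\<close> by simp
  moreover have "galois_field n = {x. poly p x = 0}"
    using False by (simp add: galois_field_def p_def poly_monom q_def)
  ultimately show ?thesis by (simp add: q_def)
qed

lemma power_CHAR_power_eq_self:
  assumes "x \<in> galois_field m" "m dvd n"
  shows "(x :: 'c::field) ^ (CHAR('c) ^ n) = x"
proof -
  obtain i where "n = m * i" using assms(2) by (rule dvdE)
  have "x ^ (CHAR('c) ^ (m * i)) = x"
  proof (induction i)
    case (Suc i)
    have "x ^ (CHAR('c) ^ (m * Suc i)) = (x ^ (CHAR('c) ^ m)) ^ (CHAR('c) ^ (m * i))"
      by (simp add: power_add power_mult)
    then show ?case using Suc assms(1) by (simp add: galois_field_def)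
  qed simp
  then show ?thesis using \<open>n = m * i\<close> by simp
qed

lemma galois_field_zero: "prime CHAR('c) \<Longrightarrow> 0 \<in> (galois_field n :: 'c::field set)"
  by (simp add: galois_field_def prime_gt_0_nat)

lemma galois_field_add:
  assumes "prime CHAR('c::field)" "x \<in> galois_field n" "y \<in> galois_field n"
  shows "x + y \<in> (galois_field n :: 'c set)"
  using assms by (auto simp: galois_field_def freshmans_dream')

lemma galois_field_power:
  assumes "x \<in> galois_field n" "0 < i"
  shows "x ^ i \<in> (galois_field n :: 'c::field set)"
proof -
  have "(x ^ i) ^ (CHAR('c) ^ n) = (x ^ (CHAR('c) ^ n)) ^ i" by (metis mult.commute power_mult)
  then show ?thesis using assms by (auto simp: galois_field_def)
qed

lemma galois_field_mult:
  assumes "x \<in> galois_field m" "m dvd n" "y \<in> galois_field n"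
  shows "x * y \<in> (galois_field n :: 'c::field set)"
  using power_CHAR_power_eq_self[OF assms(1,2)] assms(3)
  by (auto simp: galois_field_def power_mult_distrib)

section \<open>Field endomorphisms\<close>

locale field_endomorphism = field_hom \<sigma> for \<sigma> :: "'a::field \<Rightarrow> 'a"

lemma field_endomorphism_frobenius:
  assumes "prime CHAR('a::field)"
  shows "field_endomorphism (\<lambda>x::'a. x ^ (CHAR('a) ^ n))"
  using assms by unfold_locales (auto simp: freshmans_dream' power_mult_distrib prime_gt_0_nat)

lemma field_endomorphism_square:
  assumes "CHAR('a::field) = 2"
  shows "field_endomorphism (\<lambda>x::'a. x ^ 2)"
  using field_endomorphism_frobenius[where 'a = 'a and n = 1] assms by simp

context field_endomorphism
begin

subsection \<open>Moore matrices\<close>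

definition fixed_independent :: "('i \<Rightarrow> 'a) \<Rightarrow> 'i set \<Rightarrow> bool" where
  "fixed_independent a J \<longleftrightarrow>
     (\<forall>c. (\<forall>j\<in>J. \<sigma> (c j) = c j) \<longrightarrow> (\<Sum>j\<in>J. c j * a j) = 0 \<longrightarrow> (\<forall>j\<in>J. c j = 0))"

lemma fixed_independentD:
  assumes "fixed_independent a J" "\<And>j. j \<in> J \<Longrightarrow> \<sigma> (c j) = c j" "(\<Sum>j\<in>J. c j * a j) = 0" "j \<in> J"
  shows "c j = 0"
  using assms by (auto simp: fixed_independent_def)

lemma fixed_independent_subset:
  assumes "fixed_independent a J" "I \<subseteq> J" "finite J"
  shows "fixed_independent a I"
  unfolding fixed_independent_def
proof (intro allI impI ballI)
  fix c i assume coeffs: "\<forall>i\<in>I. \<sigma> (c i) = c i" "(\<Sum>i\<in>I. c i * a i) = 0" and "i \<in> I"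
  define c' where "c' j = (if j \<in> I then c j else 0)" for j
  have "(\<Sum>j\<in>J. c' j * a j) = (\<Sum>i\<in>I. c i * a i)"
    using assms(2,3) by (intro sum.mono_neutral_cong_right) (auto simp: c'_def)
  then have "c' i = 0"
    using fixed_independentD[OF assms(1), of c' i] coeffs \<open>i \<in> I\<close> assms(2) by (auto simp: c'_def)
  then show "c i = 0" using \<open>i \<in> I\<close> by (simp add: c'_def)
qed

lemma fixed_independent_image:
  assumes "fixed_independent a J"
  shows "fixed_independent (\<lambda>j. \<sigma> (a j)) J"
  unfolding fixed_independent_def
proof (intro allI impI)
  fix c assume coeffs: "\<forall>j\<in>J. \<sigma> (c j) = c j" "(\<Sum>j\<in>J. c j * \<sigma> (a j)) = 0"
  then have "\<sigma> (\<Sum>j\<in>J. c j * a j) = 0" by (simp add: hom_sum hom_mult)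
  then show "\<forall>j\<in>J. c j = 0" using fixed_independentD[OF assms] coeffs(1) by simp
qed

lemma fixed_independent_if_binary_independent:
  assumes fixed: "\<And>c. \<sigma> c = c \<Longrightarrow> c = 0 \<or> c = 1" and "finite J" and indep: "binary_independent a J"
  shows "fixed_independent a J"
  unfolding fixed_independent_def
proof (intro allI impI)
  fix c assume coeffs: "\<forall>j\<in>J. \<sigma> (c j) = c j" "(\<Sum>j\<in>J. c j * a j) = 0"
  have binary: "c j = 0 \<or> c j = 1" if "j \<in> J" for j using coeffs(1) fixed that by blast
  define I where "I = {j \<in> J. c j = 1}"
  have "sum a I = (\<Sum>j\<in>J. c j * a j)"
    unfolding I_def using \<open>finite J\<close>
    by (subst sum.inter_filter) (auto intro!: sum.cong dest: binary)
  then have "I = {}"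
    using binary_independentD[OF indep, of I] \<open>finite J\<close> coeffs(2) by (auto simp: I_def)
  then show "\<forall>j\<in>J. c j = 0" using binary by (auto simp: I_def)
qed

lemma Moore_elimination:
  assumes "\<And>e. e \<le> n \<Longrightarrow> (\<sigma> ^^ e) b + (\<Sum>j\<in>J. (\<sigma> ^^ e) (a j) * z j) = 0" and "e < n"
  shows "(\<Sum>j\<in>J. (\<sigma> ^^ e) (\<sigma> (a j)) * (\<sigma> (z j) - z j)) = 0"
proof -
  have "\<sigma> ((\<sigma> ^^ e) b + (\<Sum>j\<in>J. (\<sigma> ^^ e) (a j) * z j)) = 0"
    using assms(1)[of e] \<open>e < n\<close> by simp
  then have "(\<sigma> ^^ Suc e) b + (\<Sum>j\<in>J. (\<sigma> ^^ Suc e) (a j) * \<sigma> (z j)) = 0"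
    by (simp add: hom_add hom_sum hom_mult)
  moreover have "(\<sigma> ^^ Suc e) b + (\<Sum>j\<in>J. (\<sigma> ^^ Suc e) (a j) * z j) = 0"
    using assms(1)[of "Suc e"] \<open>e < n\<close> by simp
  ultimately have "(\<Sum>j\<in>J. (\<sigma> ^^ Suc e) (a j) * \<sigma> (z j)) = (\<Sum>j\<in>J. (\<sigma> ^^ Suc e) (a j) * z j)"
    by (metis add_left_imp_eq)
  then show ?thesis by (simp add: right_diff_distrib sum_subtractf funpow_swap1)
qed

lemma Moore_kernel_trivial:
  assumes "finite J" "fixed_independent a J"
    and "\<And>e. e < card J \<Longrightarrow> (\<Sum>j\<in>J. (\<sigma> ^^ e) (a j) * y j) = 0"
  shows "\<forall>j\<in>J. y j = 0"
  using assms
proof (induction J arbitrary: a y rule: finite_induct)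
  case empty
  then show ?case by simp
next
  case (insert n J)
  have indep_J: "fixed_independent a J"
    using fixed_independent_subset[OF insert.prems(1)] insert.hyps(1) by blast
  have relation: "(\<sigma> ^^ e) (a n) * y n + (\<Sum>j\<in>J. (\<sigma> ^^ e) (a j) * y j) = 0" if "e \<le> card J" for e
    using insert.prems(2)[of e] insert.hyps that by simp
  have "y n = 0"
  proof (rule ccontr)
    assume "y n \<noteq> 0"
    define z where "z j = y j / y n" for j
    have normalized: "(\<sigma> ^^ e) (a n) + (\<Sum>j\<in>J. (\<sigma> ^^ e) (a j) * z j) = 0" if "e \<le> card J" for e
    proof -
      have "(\<sigma> ^^ e) (a n) + (\<Sum>j\<in>J. (\<sigma> ^^ e) (a j) * z j)
          = ((\<sigma> ^^ e) (a n) * y n + (\<Sum>j\<in>J. (\<sigma> ^^ e) (a j) * y j)) / y n"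
        using \<open>y n \<noteq> 0\<close> by (simp add: z_def add_divide_distrib sum_divide_distrib)
      then show ?thesis using relation[OF that] by simp
    qed
    have "\<forall>j\<in>J. \<sigma> (z j) - z j = 0"
      using Moore_elimination[OF normalized]
      by (intro insert.IH[OF fixed_independent_image[OF indep_J]])
    then have fixed: "\<sigma> ((z(n := 1)) j) = (z(n := 1)) j" if "j \<in> insert n J" for j
      using that by auto
    have "(\<Sum>j\<in>J. (z(n := 1)) j * a j) = (\<Sum>j\<in>J. z j * a j)"
      using insert.hyps by (intro sum.cong) auto
    then have "(\<Sum>j\<in>insert n J. (z(n := 1)) j * a j) = 0"
      using normalized[of 0] insert.hyps by (simp add: mult.commute)
    then have "(z(n := 1)) n = 0"
      using fixed_independentD[OF insert.prems(1), of "z(n := 1)" n] fixed by blast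
    then show False by simp
  qed
  moreover have "\<forall>j\<in>J. y j = 0"
    using relation \<open>y n = 0\<close> by (intro insert.IH[OF indep_J]) auto
  ultimately show ?case by simp
qed

lemma Moore_system_solvable:
  fixes a :: "nat \<Rightarrow> 'a"
  assumes "fixed_independent a {..<n}"
  shows "\<exists>y. \<forall>e<n. (\<Sum>j<n. (\<sigma> ^^ e) (a j) * y j) = b e"
proof (rule square_system_solvable)
  fix y assume "\<And>e. e < n \<Longrightarrow> (\<Sum>j<n. (\<sigma> ^^ e) (a j) * y j) = 0"
  then have "\<forall>j\<in>{..<n}. y j = 0"
    by (intro Moore_kernel_trivial[OF finite_lessThan assms]) simp
  then show "\<forall>j<n. y j = 0" by simp
qed

subsection \<open>Four-wise independence\<close>

definition cubic_norm :: "'a \<Rightarrow> 'a" where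
  "cubic_norm x = x * \<sigma> x * \<sigma> (\<sigma> x)"

lemma cubic_norm_eq_0_iff [simp]: "cubic_norm x = 0 \<longleftrightarrow> x = 0"
  by (simp add: cubic_norm_def)

lemma cubic_norm_fixed: "\<sigma> (\<sigma> (\<sigma> x)) = x \<Longrightarrow> \<sigma> (cubic_norm x) = cubic_norm x"
  by (simp add: cubic_norm_def hom_mult)

lemma sum_linear_translate:
  fixes c x :: "'i \<Rightarrow> 'a"
  assumes "(\<Sum>j\<in>J. c j) = 0" "(\<Sum>j\<in>J. c j * x j) = 0"
  shows "(\<Sum>j\<in>J. c j * (x j - p)) = 0"
  using assms by (simp add: right_diff_distrib sum_subtractf flip: sum_distrib_right)

lemma sum_quadratic_translate:
  assumes fixed: "\<And>j. j \<in> J \<Longrightarrow> \<sigma> (c j) = c j"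
    and sums: "(\<Sum>j\<in>J. c j) = 0" "(\<Sum>j\<in>J. c j * x j) = 0" "(\<Sum>j\<in>J. c j * (x j * \<sigma> (x j))) = 0"
  shows "(\<Sum>j\<in>J. c j * ((x j - p) * \<sigma> (x j - p))) = 0"
proof -
  have "(\<Sum>j\<in>J. c j * \<sigma> (x j)) = 0"
    using arg_cong[OF sums(2), of \<sigma>] by (simp add: hom_sum hom_mult fixed)
  moreover have "(\<Sum>j\<in>J. c j * ((x j - p) * \<sigma> (x j - p))) =
      (\<Sum>j\<in>J. c j * (x j * \<sigma> (x j)) - c j * x j * \<sigma> p - c j * \<sigma> (x j) * p + c j * (p * \<sigma> p))"
    by (intro sum.cong) (auto simp: hom_minus algebra_simps)
  ultimately show ?thesis
    using sums by (simp add: sum.distrib sum_subtractf flip: sum_distrib_right)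
qed

lemma sum_cubic_norm_translate:
  assumes fixed: "\<And>j. j \<in> J \<Longrightarrow> \<sigma> (c j) = c j"
    and order: "\<And>j. j \<in> J \<Longrightarrow> \<sigma> (\<sigma> (\<sigma> (x j))) = x j"
    and sums: "(\<Sum>j\<in>J. c j) = 0" "(\<Sum>j\<in>J. c j * x j) = 0" "(\<Sum>j\<in>J. c j * (x j * \<sigma> (x j))) = 0"
      "(\<Sum>j\<in>J. c j * cubic_norm (x j)) = 0"
  shows "(\<Sum>j\<in>J. c j * cubic_norm (x j - p)) = 0"
proof -
  have conjugate: "(\<Sum>j\<in>J. c j * \<sigma> (f j)) = 0" if "(\<Sum>j\<in>J. c j * f j) = 0" for f
    using arg_cong[OF that, of \<sigma>] by (simp add: hom_sum hom_mult fixed)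
  have linear: "(\<Sum>j\<in>J. c j * \<sigma> (x j)) = 0" "(\<Sum>j\<in>J. c j * \<sigma> (\<sigma> (x j))) = 0"
    using conjugate[OF sums(2)] conjugate[OF conjugate[OF sums(2)]] .
  have quadratic: "(\<Sum>j\<in>J. c j * (\<sigma> (x j) * \<sigma> (\<sigma> (x j)))) = 0"
      "(\<Sum>j\<in>J. c j * (\<sigma> (\<sigma> (x j)) * x j)) = 0"
    using conjugate[OF sums(3)] conjugate[OF conjugate[OF sums(3)]]
    by (simp_all add: hom_mult order)
  have "(\<Sum>j\<in>J. c j * cubic_norm (x j - p)) =
      (\<Sum>j\<in>J. c j * cubic_norm (x j) - c j * (x j * \<sigma> (x j)) * \<sigma> (\<sigma> p)
        - c j * (\<sigma> (x j) * \<sigma> (\<sigma> (x j))) * p - c j * (\<sigma> (\<sigma> (x j)) * x j) * \<sigma> p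
        + c j * x j * (\<sigma> p * \<sigma> (\<sigma> p)) + c j * \<sigma> (x j) * (p * \<sigma> (\<sigma> p))
        + c j * \<sigma> (\<sigma> (x j)) * (p * \<sigma> p) - c j * cubic_norm p)"
    by (intro sum.cong) (auto simp: cubic_norm_def hom_minus algebra_simps)
  then show ?thesis
    using sums linear quadratic
    by (simp add: sum.distrib sum_subtractf flip: sum_distrib_right)
qed

lemma quadratic_independent_two:
  assumes fixed: "\<sigma> a = a" "\<sigma> b = b" and distinct: "x \<noteq> 0" "y \<noteq> 0" "x \<noteq> y"
    and sums: "a * x + b * y = 0" "a * (x * \<sigma> x) + b * (y * \<sigma> y) = 0"
  shows "a = 0"
proof (rule ccontr)
  assume "a \<noteq> 0"
  define c where "c = - b / a"
  have "\<sigma> c = c" using fixed by (simp add: c_def hom_div hom_uminus)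
  have "a * x = a * (c * y)" using \<open>a \<noteq> 0\<close> sums(1) by (simp add: c_def eq_neg_iff_add_eq_0)
  then have x_eq: "x = c * y" using \<open>a \<noteq> 0\<close> by simp
  have "b = - a * c" using \<open>a \<noteq> 0\<close> by (simp add: c_def)
  then have "a * (c * (c - 1)) * (y * \<sigma> y) = 0"
    using sums(2) \<open>\<sigma> c = c\<close> by (simp add: x_eq hom_mult algebra_simps)
  then have "c = 0 \<or> c = 1" using \<open>a \<noteq> 0\<close> distinct(2) by simp
  then show False using distinct x_eq by auto
qed

lemma quadratic_independent_three:
  assumes small: "finite J" "card J \<le> 3" and inj: "inj_on x J"
    and fixed: "\<And>j. j \<in> J \<Longrightarrow> \<sigma> (c j) = c j"
    and sums: "(\<Sum>j\<in>J. c j) = 0" "(\<Sum>j\<in>J. c j * x j) = 0" "(\<Sum>j\<in>J. c j * (x j * \<sigma> (x j))) = 0"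
    and "j \<in> J"
  shows "c j = 0"
proof (rule ccontr)
  assume "c j \<noteq> 0"
  then have "J \<noteq> {j}" using sums(1) by auto
  then obtain i where pivot: "i \<in> J" "i \<noteq> j" using \<open>j \<in> J\<close> by blast
  define y where "y l = x l - x i" for l
  define K where "K = J - {i, j}"
  have J_eq: "J = insert i (insert j K)" "i \<notin> insert j K" "j \<notin> K" "finite K"
    using pivot \<open>j \<in> J\<close> small(1) by (auto simp: K_def)
  have translated: "y j \<noteq> 0" "\<And>l. l \<in> K \<Longrightarrow> y l \<noteq> 0 \<and> y l \<noteq> y j"
    using inj pivot \<open>j \<in> J\<close> by (auto simp: y_def K_def inj_on_eq_iff)
  have "(\<Sum>l\<in>J. c l * y l) = 0"
    unfolding y_def using sums(1,2) by (rule sum_linear_translate)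
  then have linear: "c j * y j + (\<Sum>l\<in>K. c l * y l) = 0" using J_eq by (simp add: y_def)
  have "(\<Sum>l\<in>J. c l * (y l * \<sigma> (y l))) = 0"
    unfolding y_def using fixed sums by (rule sum_quadratic_translate)
  then have quadratic: "c j * (y j * \<sigma> (y j)) + (\<Sum>l\<in>K. c l * (y l * \<sigma> (y l))) = 0"
    using J_eq by (simp add: y_def)
  have "card K \<le> 1" using small(2) J_eq by simp
  then consider (empty) "K = {}" | (singleton) l where "K = {l}"
    using \<open>finite K\<close> by (metis card_1_singletonE card_0_eq le_neq_implies_less less_one)
  then show False
  proof cases
    case empty
    then show False using linear translated(1) \<open>c j \<noteq> 0\<close> by simp
  next
    case singleton
    then have "\<sigma> (c l) = c l" "y l \<noteq> 0" "y j \<noteq> y l" using fixed translated J_eq(1) by auto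
    moreover have "c j * y j + c l * y l = 0" "c j * (y j * \<sigma> (y j)) + c l * (y l * \<sigma> (y l)) = 0"
      using linear quadratic singleton by simp_all
    ultimately have "c j = 0"
      using quadratic_independent_two fixed[OF \<open>j \<in> J\<close>] translated(1) by blast
    then show False using \<open>c j \<noteq> 0\<close> by contradiction
  qed
qed

text \<open>Inversion \<open>y = 1 / x\<close>, with the weights multiplied by the norms, turns the constraints on
  \<open>cubic_norm x\<close>, \<open>x * \<sigma> x\<close> and \<open>x\<close> into those on \<open>1\<close>, \<open>y\<close> and \<open>y * \<sigma> y\<close>, up to powers of \<open>\<sigma>\<close>.\<close>

lemma cubic_norm_independent_three:
  assumes small: "finite J" "card J \<le> 3" and inj: "inj_on x J" and nonzero: "\<And>j. j \<in> J \<Longrightarrow> x j \<noteq> 0"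
    and fixed: "\<And>j. j \<in> J \<Longrightarrow> \<sigma> (c j) = c j" and order: "\<And>j. j \<in> J \<Longrightarrow> \<sigma> (\<sigma> (\<sigma> (x j))) = x j"
    and sums: "(\<Sum>j\<in>J. c j * x j) = 0" "(\<Sum>j\<in>J. c j * (x j * \<sigma> (x j))) = 0"
      "(\<Sum>j\<in>J. c j * cubic_norm (x j)) = 0"
    and "j \<in> J"
  shows "c j = 0"
proof -
  have "c j * cubic_norm (x j) = 0"
  proof (rule quadratic_independent_three[where x = "\<lambda>j. inverse (x j)"])
    show "inj_on (\<lambda>j. inverse (x j)) J" using inj by (simp add: inj_on_def)
    show "\<sigma> (c j * cubic_norm (x j)) = c j * cubic_norm (x j)" if "j \<in> J" for j
      using fixed order that by (simp add: hom_mult cubic_norm_fixed)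
    have "(\<Sum>j\<in>J. c j * cubic_norm (x j) * inverse (x j)) = \<sigma> (\<Sum>j\<in>J. c j * (x j * \<sigma> (x j)))"
      unfolding hom_sum using nonzero fixed
      by (intro sum.cong) (auto simp: cubic_norm_def hom_mult)
    then show "(\<Sum>j\<in>J. c j * cubic_norm (x j) * inverse (x j)) = 0" using sums(2) by simp
    have "(\<Sum>j\<in>J. c j * cubic_norm (x j) * (inverse (x j) * \<sigma> (inverse (x j)))) =
        \<sigma> (\<sigma> (\<Sum>j\<in>J. c j * x j))"
      unfolding hom_sum using nonzero fixed
      by (intro sum.cong) (auto simp: cubic_norm_def hom_mult hom_div field_simps)
    then show "(\<Sum>j\<in>J. c j * cubic_norm (x j) * (inverse (x j) * \<sigma> (inverse (x j)))) = 0"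
      using sums(1) by simp
  qed (use small sums(3) \<open>j \<in> J\<close> in auto)
  then show ?thesis using nonzero[OF \<open>j \<in> J\<close>] by simp
qed

lemma cubic_norm_independent_four:
  assumes small: "finite J" "card J \<le> 4" and inj: "inj_on x J"
    and fixed: "\<And>j. j \<in> J \<Longrightarrow> \<sigma> (c j) = c j" and order: "\<And>j. j \<in> J \<Longrightarrow> \<sigma> (\<sigma> (\<sigma> (x j))) = x j"
    and sums: "(\<Sum>j\<in>J. c j) = 0" "(\<Sum>j\<in>J. c j * x j) = 0" "(\<Sum>j\<in>J. c j * (x j * \<sigma> (x j))) = 0"
      "(\<Sum>j\<in>J. c j * cubic_norm (x j)) = 0"
    and "j \<in> J"
  shows "c j = 0"
proof (rule ccontr)
  assume "c j \<noteq> 0"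
  then have "J \<noteq> {j}" using sums(1) by auto
  then obtain i where pivot: "i \<in> J" "i \<noteq> j" using \<open>j \<in> J\<close> by blast
  define y where "y l = x l - x i" for l
  have drop: "(\<Sum>l\<in>J - {i}. f l) = 0" if "(\<Sum>l\<in>J. f l) = 0" "f i = 0" for f :: "_ \<Rightarrow> 'a"
    using sum.remove[OF small(1) pivot(1), of f] that by simp
  have "c j = 0"
  proof (rule cubic_norm_independent_three[where J = "J - {i}" and x = y])
    show "card (J - {i}) \<le> 3" using small pivot(1) by simp
    show "inj_on y (J - {i})" using inj by (auto simp: y_def inj_on_def)
    show "y l \<noteq> 0" if "l \<in> J - {i}" for l using that inj pivot by (auto simp: y_def inj_on_eq_iff)
    show "\<sigma> (\<sigma> (\<sigma> (y l))) = y l" if "l \<in> J - {i}" for l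
      using that order pivot(1) by (simp add: y_def hom_minus)
    have "(\<Sum>l\<in>J. c l * y l) = 0"
      unfolding y_def using sums(1,2) by (rule sum_linear_translate)
    then show "(\<Sum>l\<in>J - {i}. c l * y l) = 0" by (rule drop) (simp add: y_def)
    have "(\<Sum>l\<in>J. c l * (y l * \<sigma> (y l))) = 0"
      unfolding y_def using fixed sums(1-3) by (rule sum_quadratic_translate)
    then show "(\<Sum>l\<in>J - {i}. c l * (y l * \<sigma> (y l))) = 0" by (rule drop) (simp add: y_def)
    have "(\<Sum>l\<in>J. c l * cubic_norm (y l)) = 0"
      unfolding y_def using fixed order sums by (rule sum_cubic_norm_translate)
    then show "(\<Sum>l\<in>J - {i}. c l * cubic_norm (y l)) = 0" by (rule drop) (simp add: y_def)
  qed (use small(1) fixed pivot \<open>j \<in> J\<close> in auto)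
  then show False using \<open>c j \<noteq> 0\<close> by contradiction
qed

end

section \<open>MDS codes\<close>

lemma card_data_vectors:
  "card (data_vectors k :: (nat \<Rightarrow> 'a::{finite,zero}) set) = card (UNIV :: 'a set) ^ k"
proof -
  have "bij_betw (\<lambda>x. restrict x {..<k}) (data_vectors k) ({..<k} \<rightarrow>\<^sub>E (UNIV :: 'a set))"
    by (rule bij_betw_byWitness[where f' = "\<lambda>x i. if i < k then x i else 0"])
      (auto simp: data_vectors_def fun_eq_iff PiE_def extensional_def)
  then have "card (data_vectors k :: (nat \<Rightarrow> 'a) set) = card ({..<k} \<rightarrow>\<^sub>E (UNIV :: 'a set))"
    by (rule bij_betw_same_card)
  then show ?thesis by (simp add: card_PiE)
qed

lemma ex_codeword_vanishing_on:
  fixes C :: "('i \<Rightarrow> 'a::{finite,ab_group_add}) set"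
  assumes diff: "\<And>c d. c \<in> C \<Longrightarrow> d \<in> C \<Longrightarrow> c - d \<in> C"
    and "finite T" and card: "card (UNIV :: 'a set) ^ card T < card C"
  shows "\<exists>c\<in>C. c \<noteq> 0 \<and> (\<forall>i\<in>T. c i = 0)"
proof -
  have "(\<lambda>c. restrict c T) ` C \<subseteq> T \<rightarrow>\<^sub>E UNIV" by auto
  then have "card ((\<lambda>c. restrict c T) ` C) \<le> card (T \<rightarrow>\<^sub>E (UNIV :: 'a set))"
    using \<open>finite T\<close> by (intro card_mono finite_PiE) auto
  then have "\<not> inj_on (\<lambda>c. restrict c T) C"
    using card \<open>finite T\<close> by (intro pigeonhole) (simp add: card_PiE)
  then obtain c d where collision: "c \<in> C" "d \<in> C" "c \<noteq> d" "restrict c T = restrict d T"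
    unfolding inj_on_def by blast
  have "c i = d i" if "i \<in> T" for i using fun_cong[OF collision(4), of i] that by simp
  then show ?thesis using diff collision(1-3) by (intro bexI[of _ "c - d"]) auto
qed

text \<open>By the Singleton bound, it suffices to bound the weights from below.\<close>

lemma is_mds_codeI:
  fixes C :: "(nat \<Rightarrow> 'a::{finite,field}) set"
  assumes coords: "finite S" "card S = k + h" and "0 < k"
    and card: "card C = card (UNIV :: 'a set) ^ k"
    and diff: "\<And>c d. c \<in> C \<Longrightarrow> d \<in> C \<Longrightarrow> c - d \<in> C"
    and weight: "\<And>c. c \<in> C \<Longrightarrow> c \<noteq> 0 \<Longrightarrow> h < hamming_weight S c"
  shows "is_mds_code S k C"
proof -
  have "k - 1 \<le> card S" using coords(2) by simp
  then obtain T where subset: "T \<subseteq> S" "card T = k - 1" "finite T"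
    by (rule obtain_subset_with_card_n)
  have "1 < card (UNIV :: 'a set)" using card_mono[of UNIV "{0, 1 :: 'a}"] by simp
  then have "card (UNIV :: 'a set) ^ card T < card C"
    unfolding card subset(2) using \<open>0 < k\<close> by (intro power_strict_increasing) auto
  then obtain c where codeword: "c \<in> C" "c \<noteq> 0" "\<And>i. i \<in> T \<Longrightarrow> c i = 0"
    using ex_codeword_vanishing_on[OF diff subset(3)] by blast
  have "hamming_weight S c \<le> card (S - T)"
    unfolding hamming_weight_def using coords(1) codeword(3) by (intro card_mono) auto
  also have "\<dots> = h + 1" using subset coords \<open>0 < k\<close> by (simp add: card_Diff_subset)
  finally have "hamming_weight S c = h + 1" using weight[OF codeword(1,2)] by simp
  moreover have "finite {hamming_weight S c | c. c \<in> C \<and> c \<noteq> 0}"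
    by (rule finite_subset[of _ "{..card S}"])
      (use coords(1) in \<open>auto simp: hamming_weight_def card_mono\<close>)
  ultimately have "Min {hamming_weight S c | c. c \<in> C \<and> c \<noteq> 0} = h + 1"
    using codeword(1,2) weight by (intro Min_eqI) (force simp: Suc_le_eq)+
  then show ?thesis
    using card coords(2) unfolding is_mds_code_def min_distance_def zero_fun_def by simp
qed

lemma is_mds_code_image:
  fixes F :: "(nat \<Rightarrow> 'a::{finite,field}) \<Rightarrow> nat \<Rightarrow> 'a"
  assumes "additive F" "finite S" "card S = k + h" "0 < k"
    and weight: "\<And>x. x \<in> data_vectors k \<Longrightarrow> hamming_weight S (F x) \<le> h \<Longrightarrow> x = 0"
  shows "is_mds_code S k (F ` data_vectors k)"
proof (rule is_mds_codeI)
  interpret additive F by fact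
  have diff_data: "x - y \<in> data_vectors k"
    if "x \<in> data_vectors k" "y \<in> data_vectors k" for x y :: "nat \<Rightarrow> 'a"
    using that by (simp add: data_vectors_def)
  have "inj_on F (data_vectors k)"
  proof (rule inj_onI)
    fix x y assume collision: "x \<in> data_vectors k" "y \<in> data_vectors k" "F x = F y"
    then have "hamming_weight S (F (x - y)) = 0" by (simp add: diff hamming_weight_def)
    then have "x - y = 0" using weight[OF diff_data] collision(1,2) by simp
    then show "x = y" by simp
  qed
  then show "card (F ` data_vectors k) = card (UNIV :: 'a set) ^ k"
    by (simp add: card_image card_data_vectors)
  show "c - d \<in> F ` data_vectors k" if "c \<in> F ` data_vectors k" "d \<in> F ` data_vectors k" for c d
    using that diff_data by (auto simp flip: diff)
  show "h < hamming_weight S c" if "c \<in> F ` data_vectors k" "c \<noteq> 0" for c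
    using that weight zero by (metis imageE not_le)
qed (use assms in auto)

section \<open>Local codes\<close>

definition group_of :: "nat \<Rightarrow> nat \<Rightarrow> (nat \<Rightarrow> nat) \<Rightarrow> nat \<Rightarrow> nat" where
  "group_of k h g i = (if i < k + h then g i else i - (k + h))"

lemma group_of_less:
  "valid_grouping k r h g \<Longrightarrow> i < code_length k r h \<Longrightarrow> group_of k h g i < (k + h) div r"
  by (auto simp: valid_grouping_def code_length_def group_of_def)

lemma mem_local_group_iff:
  assumes "j < (k + h) div r"
  shows "i \<in> local_group k h g j \<longleftrightarrow> i < code_length k r h \<and> group_of k h g i = j"
  using assms by (auto simp: local_group_def code_length_def group_of_def)

lemma sum_group_of:
  fixes c :: "nat \<Rightarrow> 'a::comm_semiring_0"
  assumes "valid_grouping k r h g"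
  shows "(\<Sum>i<code_length k r h. f (group_of k h g i) * c i) =
    (\<Sum>j<(k + h) div r. f j * sum c (local_group k h g j))"
proof -
  let ?G = "group_of k h g"
  have "(\<Sum>i<code_length k r h. f (?G i) * c i) =
      (\<Sum>j<(k + h) div r. \<Sum>i | i \<in> {..<code_length k r h} \<and> ?G i = j. f (?G i) * c i)"
    using group_of_less[OF assms] by (intro sum.group[symmetric]) auto
  also have "\<dots> = (\<Sum>j<(k + h) div r. f j * sum c (local_group k h g j))"
    unfolding sum_distrib_left by (intro sum.cong) (auto simp: mem_local_group_iff)
  finally show ?thesis .
qed

lemma additive_local_encode: "additive (local_encode k r h H g)"
proof -
  have "sys_part k h H (x + y) i = sys_part k h H x i + sys_part k h H y i" for x y i
    by (simp add: sys_part_def distrib_left sum.distrib)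
  then show ?thesis by unfold_locales (auto simp: local_encode_def sum.distrib)
qed

lemma sum_local_group_local_encode:
  fixes H :: "nat \<Rightarrow> nat \<Rightarrow> 'a::field"
  assumes "CHAR('a) = 2" and "j < (k + h) div r"
  shows "sum (local_encode k r h H g x) (local_group k h g j) = 0"
proof -
  have "(\<Sum>i | i < k + h \<and> g i = j. local_encode k r h H g x i) =
      (\<Sum>i | i < k + h \<and> g i = j. sys_part k h H x i)"
    by (intro sum.cong) (auto simp: local_encode_def)
  also have "\<dots> = local_encode k r h H g x (k + h + j)"
    using assms(2) by (simp add: local_encode_def)
  finally show ?thesis
    by (simp add: local_group_def double_CHAR_2[OF assms(1)])
qed

definition local_transversal :: "nat \<Rightarrow> nat \<Rightarrow> nat \<Rightarrow> (nat \<Rightarrow> nat) \<Rightarrow> (nat \<Rightarrow> nat) \<Rightarrow> bool" where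
  "local_transversal k r h g e \<longleftrightarrow> (\<forall>j<(k + h) div r. e j \<in> local_group k h g j)"

lemma local_transversalD:
  assumes "local_transversal k r h g e" "j < (k + h) div r"
  shows "e j < code_length k r h" "group_of k h g (e j) = j"
  using assms mem_local_group_iff by (auto simp: local_transversal_def)

definition surviving_coords :: "nat \<Rightarrow> nat \<Rightarrow> nat \<Rightarrow> (nat \<Rightarrow> nat) \<Rightarrow> nat set" where
  "surviving_coords k r h e = {..<code_length k r h} - e ` {..<(k + h) div r}"

lemma mem_surviving_coords_iff:
  assumes "valid_grouping k r h g" "local_transversal k r h g e"
  shows "i \<in> surviving_coords k r h e \<longleftrightarrow> i < code_length k r h \<and> e (group_of k h g i) \<noteq> i"
  using local_transversalD(2)[OF assms(2)] group_of_less[OF assms(1)]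
  by (force simp: surviving_coords_def)

lemma finite_surviving_coords [simp]: "finite (surviving_coords k r h e)"
  by (simp add: surviving_coords_def)

lemma card_surviving_coords:
  assumes "local_transversal k r h g e"
  shows "card (surviving_coords k r h e) = k + h"
proof -
  have "inj_on e {..<(k + h) div r}"
    using local_transversalD(2)[OF assms] by (intro inj_on_inverseI[of _ "group_of k h g"]) auto
  moreover have "e ` {..<(k + h) div r} \<subseteq> {..<code_length k r h}"
    using local_transversalD(1)[OF assms] by auto
  ultimately show ?thesis
    by (simp add: surviving_coords_def card_Diff_subset card_image code_length_def)
qed

lemma obtain_local_transversal:
  assumes grouping: "valid_grouping k r h g" and erased: "E \<subseteq> {..<code_length k r h}"
    and one_per_group: "\<forall>j<(k + h) div r. card (E \<inter> local_group k h g j) = 1"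
  obtains e
    where "local_transversal k r h g e" "{..<code_length k r h} - E = surviving_coords k r h e"
proof -
  have "\<forall>j. \<exists>i. j < (k + h) div r \<longrightarrow> E \<inter> local_group k h g j = {i}"
    using one_per_group by (auto simp: card_1_singleton_iff)
  then obtain e where representative: "\<And>j. j < (k + h) div r \<Longrightarrow> E \<inter> local_group k h g j = {e j}"
    by (metis choice)
  have "E = e ` {..<(k + h) div r}"
  proof (intro equalityI subsetI)
    fix i assume "i \<in> E"
    then have group_less: "group_of k h g i < (k + h) div r"
      using erased group_of_less[OF grouping] by auto
    then have "i \<in> E \<inter> local_group k h g (group_of k h g i)"
      using \<open>i \<in> E\<close> erased by (auto simp: mem_local_group_iff[OF group_less])
    then show "i \<in> e ` {..<(k + h) div r}" using representative[OF group_less] group_less by auto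
  qed (use representative in blast)
  then have "{..<code_length k r h} - E = surviving_coords k r h e"
    by (simp add: surviving_coords_def)
  moreover have "local_transversal k r h g e"
    using representative by (auto simp: local_transversal_def)
  ultimately show thesis by (rule that[rotated])
qed

lemma eq_0_if_eq_0_on_surviving_coords:
  assumes grouping: "valid_grouping k r h g" and transversal: "local_transversal k r h g e"
    and local: "\<And>j. j < (k + h) div r \<Longrightarrow> sum c (local_group k h g j) = 0"
    and survivors: "\<And>i. i \<in> surviving_coords k r h e \<Longrightarrow> c i = 0"
    and coord: "i < code_length k r h"
  shows "c i = 0"
proof (cases "i \<in> surviving_coords k r h e")
  case False
  let ?j = "group_of k h g i"
  have group_less: "?j < (k + h) div r" using grouping coord by (rule group_of_less)
  have "e ?j = i" using False coord mem_surviving_coords_iff[OF grouping transversal] by simp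
  then have "c l = 0" if "l \<in> local_group k h g ?j - {i}" for l
    using that
    by (intro survivors)
      (auto simp: mem_surviving_coords_iff[OF grouping transversal] mem_local_group_iff[OF group_less])
  moreover have "i \<in> local_group k h g ?j"
    using coord by (simp add: mem_local_group_iff[OF group_less])
  moreover have "finite (local_group k h g ?j)" by (simp add: local_group_def)
  ultimately have "sum c (local_group k h g ?j) = c i" by (simp add: sum.remove)
  then show ?thesis using local[OF group_less] by simp
qed (rule survivors)

context field_endomorphism
begin

definition parity_checks ::
  "nat \<Rightarrow> nat \<Rightarrow> nat \<Rightarrow> (nat \<Rightarrow> nat) \<Rightarrow> (nat \<Rightarrow> 'a) \<Rightarrow> (nat \<Rightarrow> 'a) \<Rightarrow> bool" where
  "parity_checks k r h g \<alpha> c \<longleftrightarrow>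
     (\<forall>j<(k + h) div r. sum c (local_group k h g j) = 0) \<and>
     (\<forall>d<h. (\<Sum>i<code_length k r h. (\<sigma> ^^ d) (\<alpha> i) * c i) = 0)"

text \<open>Eliminating the coordinate \<open>e j\<close> of every group by its local parity check turns the column of
  coordinate \<open>i\<close> in the heavy checks into the conjugates of \<open>\<alpha> i - \<alpha> (e (group_of k h g i))\<close>.\<close>

definition independent_points ::
  "nat \<Rightarrow> nat \<Rightarrow> nat \<Rightarrow> (nat \<Rightarrow> nat) \<Rightarrow> (nat \<Rightarrow> 'a) \<Rightarrow> bool" where
  "independent_points k r h g \<alpha> \<longleftrightarrow>
     (\<forall>e I. local_transversal k r h g e \<longrightarrow> I \<subseteq> surviving_coords k r h e \<longrightarrow> card I \<le> h \<longrightarrow>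
        fixed_independent (\<lambda>i. \<alpha> i - \<alpha> (e (group_of k h g i))) I)"

lemma independent_pointsD:
  assumes "independent_points k r h g \<alpha>" "local_transversal k r h g e"
    and "I \<subseteq> surviving_coords k r h e" "card I \<le> h"
  shows "fixed_independent (\<lambda>i. \<alpha> i - \<alpha> (e (group_of k h g i))) I"
  using assms by (simp add: independent_points_def)

lemma fixed_independent_heavy_points:
  assumes "independent_points k r h g \<alpha>" and parity: "\<And>i. k + h \<le> i \<Longrightarrow> \<alpha> i = 0"
  shows "fixed_independent (\<lambda>j. \<alpha> (k + j)) {..<h}"
  unfolding fixed_independent_def
proof (intro allI impI)
  let ?e = "\<lambda>j. k + h + j"
  have "local_transversal k r h g ?e" by (simp add: local_transversal_def local_group_def)
  moreover have "{k..<k + h} \<subseteq> surviving_coords k r h ?e"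
    by (auto simp: surviving_coords_def code_length_def)
  moreover have "card {k..<k + h} \<le> h" by simp
  ultimately have indep: "fixed_independent (\<lambda>i. \<alpha> i - \<alpha> (?e (group_of k h g i))) {k..<k + h}"
    by (rule independent_pointsD[OF assms(1)])
  fix c assume coeffs: "\<forall>j\<in>{..<h}. \<sigma> (c j) = c j" "(\<Sum>j<h. c j * \<alpha> (k + j)) = 0"
  have "(\<Sum>i=k..<k + h. c (i - k) * (\<alpha> i - \<alpha> (?e (group_of k h g i)))) = (\<Sum>j<h. c j * \<alpha> (k + j))"
    by (rule sum.reindex_bij_witness[of _ "\<lambda>j. k + j" "\<lambda>i. i - k"]) (auto simp: parity)
  then have vanishing: "(\<Sum>i=k..<k + h. c (i - k) * (\<alpha> i - \<alpha> (?e (group_of k h g i)))) = 0"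
    using coeffs(2) by simp
  have coeff_0: "c (i - k) = 0" if "i \<in> {k..<k + h}" for i
    by (rule fixed_independentD[OF indep _ vanishing that]) (use coeffs(1) in auto)
  show "\<forall>j\<in>{..<h}. c j = 0"
  proof
    fix j assume "j \<in> {..<h}"
    then show "c j = 0" using coeff_0[of "k + j"] by simp
  qed
qed

lemma ex_heavy_parities:
  assumes "fixed_independent (\<lambda>j. \<alpha> (k + j)) {..<h}"
  obtains H where "\<And>d x. d < h \<Longrightarrow> (\<Sum>i<k + h. (\<sigma> ^^ d) (\<alpha> i) * sys_part k h H x i) = 0"
proof -
  have "\<forall>i. \<exists>y. \<forall>d<h. (\<Sum>j<h. (\<sigma> ^^ d) (\<alpha> (k + j)) * y j) = - (\<sigma> ^^ d) (\<alpha> i)"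
    by (intro allI Moore_system_solvable[OF assms])
  then obtain y
    where solution: "\<And>i d. d < h \<Longrightarrow> (\<Sum>j<h. (\<sigma> ^^ d) (\<alpha> (k + j)) * y i j) = - (\<sigma> ^^ d) (\<alpha> i)"
    by metis
  let ?sys = "sys_part k h (\<lambda>j i. y i j)"
  have split: "(\<Sum>i<k + n. f i) = (\<Sum>i<k. f i) + (\<Sum>j<n. f (k + j))" for f :: "nat \<Rightarrow> 'a" and n
    by (induction n) (simp_all add: add.assoc)
  have "(\<Sum>i<k + h. (\<sigma> ^^ d) (\<alpha> i) * ?sys x i) = 0" if "d < h" for d x
  proof -
    have "(\<Sum>j<h. (\<sigma> ^^ d) (\<alpha> (k + j)) * ?sys x (k + j)) =
        (\<Sum>j<h. \<Sum>i<k. (\<sigma> ^^ d) (\<alpha> (k + j)) * y i j * x i)"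
      by (intro sum.cong) (auto simp: sys_part_def sum_distrib_left mult.assoc)
    also have "\<dots> = (\<Sum>i<k. (\<Sum>j<h. (\<sigma> ^^ d) (\<alpha> (k + j)) * y i j) * x i)"
      by (subst sum.swap) (simp add: sum_distrib_right)
    also have "\<dots> = - (\<Sum>i<k. (\<sigma> ^^ d) (\<alpha> i) * ?sys x i)"
      by (simp add: solution[OF that] sys_part_def sum_negf)
    finally show ?thesis by (simp add: split)
  qed
  then show thesis by (rule that)
qed

lemma funpow_zero: "(\<sigma> ^^ d) 0 = 0"
  by (induction d) simp_all

lemma funpow_diff: "(\<sigma> ^^ d) (x - y) = (\<sigma> ^^ d) x - (\<sigma> ^^ d) y"
  by (induction d) (simp_all add: hom_minus)

lemma ex_parity_checks_local_encode:
  assumes "CHAR('a) = 2" and indep: "independent_points k r h g \<alpha>"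
    and parity: "\<And>i. k + h \<le> i \<Longrightarrow> \<alpha> i = 0"
  obtains H where "\<And>x. parity_checks k r h g \<alpha> (local_encode k r h H g x)"
proof -
  obtain H where heavy: "\<And>d x. d < h \<Longrightarrow> (\<Sum>i<k + h. (\<sigma> ^^ d) (\<alpha> i) * sys_part k h H x i) = 0"
    using ex_heavy_parities[OF fixed_independent_heavy_points[OF indep parity]] by blast
  have "(\<Sum>i<code_length k r h. (\<sigma> ^^ d) (\<alpha> i) * local_encode k r h H g x i) =
      (\<Sum>i<k + h. (\<sigma> ^^ d) (\<alpha> i) * sys_part k h H x i)" for d x
    by (intro sum.mono_neutral_cong_right)
      (auto simp: code_length_def parity funpow_zero local_encode_def)
  then have "parity_checks k r h g \<alpha> (local_encode k r h H g x)" for x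
    using heavy sum_local_group_local_encode[OF assms(1)] by (simp add: parity_checks_def)
  then show thesis by (rule that)
qed

lemma sum_differences_eq_0:
  assumes grouping: "valid_grouping k r h g" and checks: "parity_checks k r h g \<alpha> c" and "d < h"
  shows "(\<Sum>i<code_length k r h. (\<sigma> ^^ d) (\<alpha> i - \<alpha> (e (group_of k h g i))) * c i) = 0"
proof -
  have "(\<Sum>i<code_length k r h. (\<sigma> ^^ d) (\<alpha> (e (group_of k h g i))) * c i) = 0"
    using sum_group_of[OF grouping, of "\<lambda>j. (\<sigma> ^^ d) (\<alpha> (e j))" c] checks
    by (simp add: parity_checks_def)
  then show ?thesis
    using checks \<open>d < h\<close>
    by (simp add: funpow_diff left_diff_distrib sum_subtractf parity_checks_def)
qed

lemma eq_0_if_low_surviving_weight: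
  assumes grouping: "valid_grouping k r h g" and indep: "independent_points k r h g \<alpha>"
    and transversal: "local_transversal k r h g e" and checks: "parity_checks k r h g \<alpha> c"
    and weight: "hamming_weight (surviving_coords k r h e) c \<le> h" and coord: "i < code_length k r h"
  shows "c i = 0"
proof (rule eq_0_if_eq_0_on_surviving_coords[OF grouping transversal _ _ coord])
  let ?N = "code_length k r h" and ?S = "surviving_coords k r h e"
  let ?a = "\<lambda>i. \<alpha> i - \<alpha> (e (group_of k h g i))"
  show "sum c (local_group k h g j) = 0" if "j < (k + h) div r" for j
    using checks that by (simp add: parity_checks_def)
  define D where "D = {i \<in> ?S. c i \<noteq> 0}"
  have "card D \<le> h" using weight by (simp add: D_def hamming_weight_def)
  have "\<forall>i\<in>D. c i = 0"
  proof (rule Moore_kernel_trivial)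
    show "finite D" by (simp add: D_def)
    show "fixed_independent ?a D"
      by (rule independent_pointsD[OF indep transversal _ \<open>card D \<le> h\<close>]) (auto simp: D_def)
  next
    fix d assume "d < card D"
    have "(\<sigma> ^^ d) (?a i) * c i = 0" if "i \<in> {..<?N} - D" for i
    proof (cases "i \<in> ?S")
      case False
      then have "e (group_of k h g i) = i"
        using that mem_surviving_coords_iff[OF grouping transversal] by simp
      then show ?thesis by (simp add: funpow_zero)
    qed (use that in \<open>simp add: D_def\<close>)
    moreover have "D \<subseteq> {..<?N}" by (auto simp: D_def surviving_coords_def)
    ultimately have "(\<Sum>i\<in>D. (\<sigma> ^^ d) (?a i) * c i) = (\<Sum>i<?N. (\<sigma> ^^ d) (?a i) * c i)"
      by (intro sum.mono_neutral_left) auto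
    also have "\<dots> = 0"
      using \<open>d < card D\<close> \<open>card D \<le> h\<close> by (intro sum_differences_eq_0[OF grouping checks]) simp
    finally show "(\<Sum>i\<in>D. (\<sigma> ^^ d) (?a i) * c i) = 0" .
  qed
  then show "c i = 0" if "i \<in> ?S" for i using that by (auto simp: D_def)
qed

end

lemma is_mds_code_punctured_local_code:
  fixes \<sigma> :: "'a::{finite,field} \<Rightarrow> 'a"
  assumes "field_endomorphism \<sigma>" and "0 < k" and grouping: "valid_grouping k r h g"
    and indep: "field_endomorphism.independent_points \<sigma> k r h g \<alpha>"
    and checks: "\<And>x. field_endomorphism.parity_checks \<sigma> k r h g \<alpha> (local_encode k r h H g x)"
    and transversal: "local_transversal k r h g e"
  shows "is_mds_code (surviving_coords k r h e) k
    (restrict_coords (surviving_coords k r h e) (local_code k r h H g))"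
proof -
  interpret field_endomorphism \<sigma> by fact
  let ?c = "local_encode k r h H g" and ?S = "surviving_coords k r h e"
  interpret encode: additive ?c by (rule additive_local_encode)
  define F where "F x = (\<lambda>i. if i \<in> ?S then ?c x i else 0)" for x
  have "is_mds_code ?S k (F ` data_vectors k)"
  proof (rule is_mds_code_image)
    show "additive F" by unfold_locales (auto simp: F_def encode.add)
    show "card ?S = k + h" using transversal by (rule card_surviving_coords)
    fix x assume data: "x \<in> data_vectors k" and "hamming_weight ?S (F x) \<le> h"
    then have "hamming_weight ?S (?c x) \<le> h"
      by (simp add: hamming_weight_def F_def cong: conj_cong)
    then have encode_0: "?c x i = 0" if "i < code_length k r h" for i
      using eq_0_if_low_surviving_weight[OF grouping indep transversal checks] that by blast
    show "x = 0"
    proof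
      fix i
      have "?c x i = x i" if "i < k" using that by (simp add: local_encode_def sys_part_def)
      then show "x i = 0 i"
        using encode_0[of i] data
        by (cases "i < k") (simp_all add: code_length_def data_vectors_def)
    qed
  qed (use \<open>0 < k\<close> in simp_all)
  then show ?thesis by (simp add: restrict_coords_def local_code_def F_def image_image)
qed

lemma ex_maximally_recoverable:
  fixes \<sigma> :: "'a::{finite,field} \<Rightarrow> 'a"
  assumes endomorphism: "field_endomorphism \<sigma>" and "CHAR('a) = 2" "0 < k"
    and grouping: "valid_grouping k r h g"
    and indep: "field_endomorphism.independent_points \<sigma> k r h g \<alpha>"
    and parity: "\<And>i. k + h \<le> i \<Longrightarrow> \<alpha> i = 0"
  shows "\<exists>H :: nat \<Rightarrow> nat \<Rightarrow> 'a. maximally_recoverable k r h H g"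
proof -
  interpret field_endomorphism \<sigma> by fact
  obtain H where checks: "\<And>x. parity_checks k r h g \<alpha> (local_encode k r h H g x)"
    using ex_parity_checks_local_encode[OF \<open>CHAR('a) = 2\<close> indep parity] by blast
  have "is_mds_code ({..<code_length k r h} - E) k
      (restrict_coords ({..<code_length k r h} - E) (local_code k r h H g))"
    if erased: "E \<subseteq> {..<code_length k r h}"
      "\<forall>j<(k + h) div r. card (E \<inter> local_group k h g j) = 1" for E
  proof -
    obtain e where transversal: "local_transversal k r h g e"
      and survivors: "{..<code_length k r h} - E = surviving_coords k r h e"
      using obtain_local_transversal[OF grouping erased] .
    show ?thesis
      unfolding survivors
      by (rule is_mds_code_punctured_local_code[OF endomorphism \<open>0 < k\<close> grouping indep checks
            transversal])
  qed
  then have "maximally_recoverable k r h H g" unfolding maximally_recoverable_def by blast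
  then show ?thesis by blast
qed

section \<open>The construction\<close>

lemma valid_grouping_div:
  assumes "0 < r" "r dvd k + h"
  shows "valid_grouping k r h (\<lambda>i. i div r)"
proof -
  obtain l where length_eq: "k + h = r * l" using assms(2) by (rule dvdE)
  have "{i. i < r * l \<and> i div r = j} = {r * j..<r * Suc j}" if "j < l" for j
  proof -
    have group: "i div r = j \<longleftrightarrow> r * j \<le> i \<and> i < r * Suc j" for i
      using div_nat_eqI[of r j i] dividend_less_times_div[OF assms(1), of i] by auto
    have "r * Suc j \<le> r * l" using that by (intro mult_le_mono2) simp
    then have "i < r * l" if "i < r * Suc j" for i using that by (rule less_le_trans[rotated])
    then show ?thesis unfolding group by (auto simp del: mult_Suc_right)
  qed
  then show ?thesis
    using assms(1) by (simp add: valid_grouping_def length_eq div_less_iff_less_mult mult.commute)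
qed

definition groupwise_independent ::
  "nat \<Rightarrow> nat \<Rightarrow> nat \<Rightarrow> (nat \<Rightarrow> nat) \<Rightarrow> (nat \<Rightarrow> 'b::comm_monoid_add) \<Rightarrow> bool" where
  "groupwise_independent k r h g B \<longleftrightarrow> (\<forall>i\<ge>k + h. B i = 0) \<and>
     (\<forall>j<(k + h) div r. binary_independent B {i. i < k + h \<and> g i = j})"

lemma ex_groupwise_independent:
  fixes V :: "'b::ab_group_add set"
  assumes "valid_grouping k r h g" and char2: "\<And>x::'b. x + x = 0"
    and group: "0 \<in> V" "\<And>x y. x \<in> V \<Longrightarrow> y \<in> V \<Longrightarrow> x + y \<in> V" "card V = 2 ^ r"
  shows "\<exists>B. range B \<subseteq> V \<and> groupwise_independent k r h g B"
proof -
  obtain b :: "nat \<Rightarrow> 'b" where family: "b ` {..<r} \<subseteq> V" "binary_independent b {..<r}"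
    using ex_binary_independent[OF char2 group] by blast
  let ?A = "\<lambda>j. {i. i < k + h \<and> g i = j}"
  have "\<forall>j. \<exists>f. j < (k + h) div r \<longrightarrow> bij_betw f (?A j) {..<r}"
    using assms(1) by (auto simp: valid_grouping_def intro!: finite_same_card_bij)
  then obtain f where enumeration: "\<And>j. j < (k + h) div r \<Longrightarrow> bij_betw (f j) (?A j) {..<r}" by metis
  define B where "B i = (if i < k + h then b (f (g i) i) else 0)" for i
  have "B i \<in> V" for i
  proof (cases "i < k + h")
    case True
    then have "g i < (k + h) div r" using assms(1) by (simp add: valid_grouping_def)
    then show ?thesis using True bij_betwE[OF enumeration] family(1) by (auto simp: B_def)
  qed (simp add: B_def group(1))
  moreover have "binary_independent B (?A j)" if "j < (k + h) div r" for j
  proof -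
    have "binary_independent (\<lambda>i. b (f j i)) (?A j)"
      using enumeration[OF that]
      by (intro binary_independent_reindex[OF family(2)]) (auto simp: bij_betw_def)
    then show ?thesis by (subst binary_independent_cong) (auto simp: B_def)
  qed
  moreover have "\<forall>i\<ge>k + h. B i = 0" by (simp add: B_def)
  ultimately show ?thesis unfolding groupwise_independent_def by (intro exI[of _ B]) blast
qed

context field_endomorphism
begin

definition norm_curve :: "'a \<Rightarrow> 'a \<Rightarrow> 'a \<times> 'a \<times> 'a \<times> 'a" where
  "norm_curve c x = (c, c * x, c * (x * \<sigma> x), c * cubic_norm x)"

lemma norm_curve_zero [simp]: "norm_curve 0 x = 0"
  by (simp add: norm_curve_def zero_prod_def)

lemma norm_curve_diff: "norm_curve (c - d) x = norm_curve c x - norm_curve d x"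
  by (simp add: norm_curve_def left_diff_distrib)

lemma groupwise_sum_eq_0_if_sum_norm_curve_eq_0:
  assumes small: "finite I" "card I \<le> 4" and inj: "inj_on x (G ` I)"
    and fixed: "\<And>i. i \<in> I \<Longrightarrow> \<sigma> (c i) = c i"
    and order: "\<And>j. j \<in> G ` I \<Longrightarrow> \<sigma> (\<sigma> (\<sigma> (x j))) = x j"
    and vanishing: "(\<Sum>i\<in>I. norm_curve (c i) (x (G i))) = 0" and "j \<in> G ` I"
  shows "(\<Sum>i | i \<in> I \<and> G i = j. c i) = 0"
proof (rule cubic_norm_independent_four[where J = "G ` I" and x = x])
  have collect: "(\<Sum>j\<in>G ` I. (\<Sum>i | i \<in> I \<and> G i = j. c i) * f j) = (\<Sum>i\<in>I. c i * f (G i))" for f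
  proof -
    have "(\<Sum>i\<in>I. c i * f (G i)) = (\<Sum>j\<in>G ` I. \<Sum>i | i \<in> I \<and> G i = j. c i * f (G i))"
      by (rule sum.image_gen[OF small(1)])
    also have "\<dots> = (\<Sum>j\<in>G ` I. (\<Sum>i | i \<in> I \<and> G i = j. c i) * f j)"
      by (intro sum.cong refl) (simp add: sum_distrib_right)
    finally show ?thesis ..
  qed
  have sums: "(\<Sum>i\<in>I. c i) = 0" "(\<Sum>i\<in>I. c i * x (G i)) = 0"
    "(\<Sum>i\<in>I. c i * (x (G i) * \<sigma> (x (G i)))) = 0" "(\<Sum>i\<in>I. c i * cubic_norm (x (G i))) = 0"
    using vanishing by (simp_all add: norm_curve_def sum_prod zero_prod_def)
  show "(\<Sum>j\<in>G ` I. \<Sum>i | i \<in> I \<and> G i = j. c i) = 0"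
    using collect[of "\<lambda>_. 1"] sums(1) by simp
  show "(\<Sum>j\<in>G ` I. (\<Sum>i | i \<in> I \<and> G i = j. c i) * x j) = 0"
    using collect[of x] sums(2) by simp
  show "(\<Sum>j\<in>G ` I. (\<Sum>i | i \<in> I \<and> G i = j. c i) * (x j * \<sigma> (x j))) = 0"
    using collect[of "\<lambda>j. x j * \<sigma> (x j)"] sums(3) by simp
  show "(\<Sum>j\<in>G ` I. (\<Sum>i | i \<in> I \<and> G i = j. c i) * cubic_norm (x j)) = 0"
    using collect[of "\<lambda>j. cubic_norm (x j)"] sums(4) by simp
  show "card (G ` I) \<le> 4" using card_image_le[OF small(1), of G] small(2) by simp
  show "\<sigma> (\<Sum>i | i \<in> I \<and> G i = j. c i) = (\<Sum>i | i \<in> I \<and> G i = j. c i)" for j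
    unfolding hom_sum using fixed by (intro sum.cong) auto
qed (use small(1) inj order \<open>j \<in> G ` I\<close> in auto)

lemma norm_curve_differences_binary_independent:
  assumes char2: "CHAR('a) = 2" and grouping: "valid_grouping k r h g"
    and transversal: "local_transversal k r h g e"
    and survivors: "I \<subseteq> surviving_coords k r h e" "card I \<le> 4"
    and weights: "\<And>i. \<sigma> (B i) = B i" "groupwise_independent k r h g B"
    and nodes: "inj_on x {..<(k + h) div r}" "\<And>j. j < (k + h) div r \<Longrightarrow> \<sigma> (\<sigma> (\<sigma> (x j))) = x j"
  shows "binary_independent
    (\<lambda>i. norm_curve (B i - B (e (group_of k h g i))) (x (group_of k h g i))) I"
  unfolding binary_independent_def
proof (intro allI impI notI)
  let ?G = "group_of k h g"
  fix I' assume subset: "I' \<subseteq> I" "finite I'" "I' \<noteq> {}"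
    and vanishing: "(\<Sum>i\<in>I'. norm_curve (B i - B (e (?G i))) (x (?G i))) = 0"
  have coords: "i < code_length k r h" "e (?G i) \<noteq> i" if "i \<in> I'" for i
    using that survivors(1) subset(1) mem_surviving_coords_iff[OF grouping transversal] by auto
  then have group_less: "?G i < (k + h) div r" if "i \<in> I'" for i
    using group_of_less[OF grouping] that by blast
  obtain i where "i \<in> I'" using subset(3) by blast
  define j where "j = ?G i"
  have group_j_less: "j < (k + h) div r" using group_less[OF \<open>i \<in> I'\<close>] by (simp add: j_def)
  have "finite I" using survivors(1) finite_surviving_coords by (rule finite_subset)
  then have "card I' \<le> 4" using card_mono[OF _ subset(1)] survivors(2) by simp
  then have "(\<Sum>i | i \<in> I' \<and> ?G i = j. B i - B (e (?G i))) = 0"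
    using subset(2) vanishing \<open>i \<in> I'\<close> nodes group_less weights(1)
    by (intro groupwise_sum_eq_0_if_sum_norm_curve_eq_0[where x = x])
      (auto simp: hom_minus j_def intro: inj_on_subset)
  moreover have "(\<Sum>i | i \<in> I' \<and> ?G i = j. B i - B (e (?G i))) =
      (\<Sum>i | i \<in> I' \<and> ?G i = j. B i - B (e j))"
    by (intro sum.cong) auto
  moreover have "(\<Sum>i | i \<in> I' \<and> ?G i = j. B i - B (e j)) \<noteq> 0"
  proof (rule binary_independent_differences[where z = "k + h + j"])
    show "binary_independent B {i. i < k + h \<and> g i = j}" "B (k + h + j) = 0"
      using weights(2) group_j_less by (simp_all add: groupwise_independent_def)
    have group: "local_group k h g j = insert (k + h + j) {i. i < k + h \<and> g i = j}"
      by (simp add: local_group_def)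
    show "e j \<in> insert (k + h + j) {i. i < k + h \<and> g i = j}"
      using transversal group_j_less unfolding group[symmetric] by (simp add: local_transversal_def)
    show "{i \<in> I'. ?G i = j} \<subseteq> insert (k + h + j) {i. i < k + h \<and> g i = j}"
      unfolding group[symmetric] using coords(1) group_j_less by (auto simp: mem_local_group_iff)
    show "e j \<notin> {i \<in> I'. ?G i = j}" using coords(2)[of "e j"] by auto
  qed (use double_CHAR_2[OF char2] subset(2) \<open>i \<in> I'\<close> in \<open>auto simp: j_def\<close>)
  ultimately show False by simp
qed

lemma independent_points_norm_curve:
  fixes \<phi> :: "'a \<times> 'a \<times> 'a \<times> 'a \<Rightarrow> 'b::field"
  assumes char2: "CHAR('a) = 2" "CHAR('b) = 2" and "h \<le> 4" and grouping: "valid_grouping k r h g"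
    and weights: "\<And>i. \<sigma> (B i) = B i" "groupwise_independent k r h g B"
    and nodes: "inj_on x {..<(k + h) div r}" "\<And>j. j < (k + h) div r \<Longrightarrow> \<sigma> (\<sigma> (\<sigma> (x j))) = x j"
    and embedding: "additive \<phi>" "inj_on \<phi> V" and group: "0 \<in> V" "\<And>u v. u \<in> V \<Longrightarrow> v \<in> V \<Longrightarrow> u + v \<in> V"
    and curve_mem: "\<And>i i' j. j < (k + h) div r \<Longrightarrow> norm_curve (B i - B i') (x j) \<in> V"
  shows "field_endomorphism.independent_points (\<lambda>x. x ^ 2) k r h g
    (\<lambda>i. \<phi> (norm_curve (B i) (x (group_of k h g i))))"
proof -
  interpret square: field_endomorphism "\<lambda>x::'b. x ^ 2"
    using char2(2) by (rule field_endomorphism_square)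
  let ?G = "group_of k h g"
  let ?\<alpha> = "\<lambda>i. \<phi> (norm_curve (B i) (x (?G i)))"
  show ?thesis
    unfolding square.independent_points_def
  proof (intro allI impI)
    fix e I assume transversal: "local_transversal k r h g e"
      and survivors: "I \<subseteq> surviving_coords k r h e" "card I \<le> h"
    let ?D = "\<lambda>i. norm_curve (B i - B (e (?G i))) (x (?G i))"
    have group_less: "?G i < (k + h) div r" if "i \<in> I" for i
      using that survivors(1) group_of_less[OF grouping]
        mem_surviving_coords_iff[OF grouping transversal] by auto
    have "card I \<le> 4" using survivors(2) \<open>h \<le> 4\<close> by simp
    then have "binary_independent ?D I"
      using norm_curve_differences_binary_independent[OF char2(1) grouping transversal survivors(1) _
          weights nodes] by simp
    then have "binary_independent (\<lambda>i. \<phi> (?D i)) I"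
      using curve_mem group_less
      by (intro binary_independent_additive_image[OF embedding group]) auto
    moreover have "\<phi> (?D i) = ?\<alpha> i - ?\<alpha> (e (?G i))" if "i \<in> I" for i
      using local_transversalD(2)[OF transversal group_less[OF that]]
      by (simp add: norm_curve_diff additive.diff[OF embedding(1)])
    ultimately have "binary_independent (\<lambda>i. ?\<alpha> i - ?\<alpha> (e (?G i))) I"
      by (simp cong: binary_independent_cong)
    moreover have "finite I" using survivors(1) finite_surviving_coords by (rule finite_subset)
    ultimately show "square.fixed_independent (\<lambda>i. ?\<alpha> i - ?\<alpha> (e (?G i))) I"
      by (intro square.fixed_independent_if_binary_independent) (auto simp: power2_eq_square)
  qed
qed

end

definition norm_curve_space :: "nat \<Rightarrow> nat \<Rightarrow> ('c::field \<times> 'c \<times> 'c \<times> 'c) set" where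
  "norm_curve_space r n =
     galois_field r \<times> galois_field (3 * n) \<times> galois_field (3 * n) \<times> galois_field n"

lemma card_norm_curve_space:
  assumes "prime CHAR('c::alg_closed_field)"
  shows "card (norm_curve_space r n :: ('c \<times> 'c \<times> 'c \<times> 'c) set) = CHAR('c) ^ (r + 7 * n)"
proof -
  have "r + 7 * n = r + (3 * n + (3 * n + n))" by simp
  then show ?thesis
    unfolding norm_curve_space_def
    by (simp only: card_cartesian_product card_galois_field[OF assms] power_add)
qed

lemma norm_curve_space_zero:
  "prime CHAR('c::field) \<Longrightarrow> 0 \<in> (norm_curve_space r n :: ('c \<times> 'c \<times> 'c \<times> 'c) set)"
  by (simp add: norm_curve_space_def zero_prod_def galois_field_zero)

lemma norm_curve_space_add:
  assumes "prime CHAR('c::field)" "u \<in> norm_curve_space r n" "v \<in> norm_curve_space r n"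
  shows "u + v \<in> (norm_curve_space r n :: ('c \<times> 'c \<times> 'c \<times> 'c) set)"
  using assms by (auto simp: norm_curve_space_def galois_field_add)

lemma ex_norm_curve_space_embedding:
  assumes char2: "CHAR('c::alg_closed_field) = 2" "\<And>x::'a. x + x = 0"
    and card: "2 ^ (r + 7 * n) \<le> card (UNIV :: 'a::{finite,ab_group_add} set)"
  shows "\<exists>\<phi> :: 'c \<times> 'c \<times> 'c \<times> 'c \<Rightarrow> 'a. additive \<phi> \<and> inj_on \<phi> (norm_curve_space r n)"
proof (rule ex_additive_embedding)
  have prime: "prime CHAR('c)" using char2(1) by simp
  let ?V = "norm_curve_space r n :: ('c \<times> 'c \<times> 'c \<times> 'c) set"
  have card_V: "card ?V = 2 ^ (r + 7 * n)" using card_norm_curve_space[OF prime] char2(1) by simp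
  then show "finite ?V" by (intro card_ge_0_finite) simp
  show "card ?V \<le> card (UNIV :: 'a set)" using card card_V by simp
  show "0 \<in> ?V" using prime by (rule norm_curve_space_zero)
  show "u + v \<in> ?V" if "u \<in> ?V" "v \<in> ?V" for u v using prime that by (rule norm_curve_space_add)
  show "u + u = 0" for u :: "'c \<times> 'c \<times> 'c \<times> 'c"
    by (cases u) (simp add: double_CHAR_2[OF char2(1)] zero_prod_def)
qed (rule char2(2))

lemma frobenius_order_three:
  assumes "x \<in> galois_field (3 * n)"
  shows "((x ^ CHAR('c) ^ n) ^ CHAR('c) ^ n) ^ CHAR('c) ^ n = (x :: 'c::field)"
proof -
  have "3 * n = n + n + n" by simp
  then show ?thesis
    using power_CHAR_power_eq_self[OF assms dvd_refl] by (simp only: power_add power_mult)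
qed

lemma norm_curve_mem_norm_curve_space:
  fixes c x :: "'c::field"
  assumes "prime CHAR('c)" "r dvd n" and weight: "c \<in> galois_field r"
    and node: "x \<in> galois_field (3 * n)"
  shows "field_endomorphism.norm_curve (\<lambda>x. x ^ CHAR('c) ^ n) c x \<in> norm_curve_space r n"
proof -
  interpret field_endomorphism "\<lambda>x::'c. x ^ CHAR('c) ^ n"
    using assms(1) by (rule field_endomorphism_frobenius)
  have "x ^ CHAR('c) ^ n \<in> galois_field (3 * n)"
    using node assms(1) by (intro galois_field_power) (auto simp: prime_gt_0_nat)
  then have "x * x ^ CHAR('c) ^ n \<in> galois_field (3 * n)"
    by (rule galois_field_mult[OF node dvd_refl])
  moreover have "cubic_norm x \<in> galois_field n"
  proof -
    have "cubic_norm x = 0" if "n = 0"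
      using node that by (subst cubic_norm_eq_0_iff) (simp add: galois_field_def)
    then show ?thesis
      using cubic_norm_fixed[OF frobenius_order_three[OF node]] unfolding galois_field_def by blast
  qed
  moreover have "r dvd 3 * n" using \<open>r dvd n\<close> by simp
  ultimately show ?thesis
    using weight node \<open>r dvd n\<close>
    by (simp add: norm_curve_def norm_curve_space_def galois_field_mult[OF weight])
qed

lemma ex_independent_points:
  fixes k r h n :: nat
  assumes char2: "CHAR('a::{finite,field}) = 2" and grouping: "valid_grouping k r h g"
    and "h \<le> 4" "r dvd n"
    and groups: "(k + h) div r \<le> 2 ^ (3 * n)" and card: "2 ^ (r + 7 * n) \<le> card (UNIV :: 'a set)"
  shows "\<exists>\<alpha> :: nat \<Rightarrow> 'a.
    field_endomorphism.independent_points (\<lambda>x. x ^ 2) k r h g \<alpha> \<and> (\<forall>i\<ge>k + h. \<alpha> i = 0)"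
proof -
  have CHAR_closure: "CHAR('a alg_closure) = 2" using char2 by simp
  then have prime: "prime CHAR('a alg_closure)" by simp
  interpret field_endomorphism "\<lambda>x::'a alg_closure. x ^ CHAR('a alg_closure) ^ n"
    using prime by (rule field_endomorphism_frobenius)
  note card_GF = card_galois_field[OF prime, unfolded CHAR_closure]
  obtain \<phi> :: "'a alg_closure \<times> 'a alg_closure \<times> 'a alg_closure \<times> 'a alg_closure \<Rightarrow> 'a"
    where embedding: "additive \<phi>" "inj_on \<phi> (norm_curve_space r n)"
    using ex_norm_curve_space_embedding[OF CHAR_closure double_CHAR_2[OF char2] card] by blast
  obtain B :: "nat \<Rightarrow> 'a alg_closure"
    where weights: "range B \<subseteq> galois_field r" "groupwise_independent k r h g B"
    using ex_groupwise_independent[OF grouping double_CHAR_2[OF CHAR_closure]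
        galois_field_zero[OF prime] galois_field_add[OF prime] card_GF] by blast
  then have weights_mem: "B i \<in> galois_field r" for i by auto
  have "finite (galois_field (3 * n) :: 'a alg_closure set)"
    using card_GF[of "3 * n"] by (intro card_ge_0_finite) simp
  then obtain x :: "nat \<Rightarrow> 'a alg_closure"
    where nodes: "x ` {..<(k + h) div r} \<subseteq> galois_field (3 * n)" "inj_on x {..<(k + h) div r}"
    using card_le_inj[of "{..<(k + h) div r}" "galois_field (3 * n) :: 'a alg_closure set"] groups
    by (auto simp: card_GF)
  then have nodes_mem: "x j \<in> galois_field (3 * n)" if "j < (k + h) div r" for j using that by auto
  have "field_endomorphism.independent_points (\<lambda>x. x ^ 2) k r h g
      (\<lambda>i. \<phi> (norm_curve (B i) (x (group_of k h g i))))"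
  proof (rule independent_points_norm_curve[OF CHAR_closure char2 \<open>h \<le> 4\<close> grouping _ weights(2)
        nodes(2) _ embedding norm_curve_space_zero[OF prime] norm_curve_space_add[OF prime]])
    show "norm_curve (B i - B i') (x j) \<in> norm_curve_space r n" if "j < (k + h) div r" for i i' j
      unfolding minus_CHAR_2[OF CHAR_closure]
      by (intro norm_curve_mem_norm_curve_space galois_field_add prime weights_mem nodes_mem
          \<open>r dvd n\<close> that)
  qed (use power_CHAR_power_eq_self[OF weights_mem \<open>r dvd n\<close>] frobenius_order_three[OF nodes_mem]
      in auto)
  moreover have "\<forall>i\<ge>k + h. \<phi> (norm_curve (B i) (x (group_of k h g i))) = 0"
    using weights(2) additive.zero[OF embedding(1)]
    by (simp add: groupwise_independent_def del: CHAR_alg_closure)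
  ultimately show ?thesis by (intro exI conjI)
qed

lemma CHAR_eq_prime_if_card_eq_power:
  assumes "prime p" and "card (UNIV :: 'a::{finite,idom} set) = p ^ t"
  shows "CHAR('a) = p"
proof -
  have "prime CHAR('a)"
    using CHAR_dvd_CARD[where 'a = 'a] prime_CHAR_semidom finite_imp_CHAR_pos by (metis finite)
  moreover have "CHAR('a) dvd p ^ t" using CHAR_dvd_CARD[where 'a = 'a] assms(2) by simp
  ultimately show ?thesis using assms(1) prime_dvd_power primes_dvd_imp_eq by blast
qed

theorem theorem18:
  fixes k r m t :: nat
  assumes "0 < k" and "0 < r" and "r dvd (k + 4)"
    and "m = (LEAST m::nat. 1 \<le> m \<and> 3 dvd (m - 1) \<and> (k + 4) div r \<le> 2 ^ (r * (m - 1)))"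
    and "t = r * (2 * m + (m - 1) div 3)"
    and "card (UNIV :: ('a::{finite,field}) set) = 2 ^ t"
  shows "\<exists>(H :: nat \<Rightarrow> nat \<Rightarrow> 'a) g.
           valid_grouping k r 4 g \<and> maximally_recoverable k r 4 H g"
proof -
  let ?P = "\<lambda>m::nat. 1 \<le> m \<and> 3 dvd (m - 1) \<and> (k + 4) div r \<le> 2 ^ (r * (m - 1))"
  have "(k + 4) div r \<le> k + 4" by (rule div_le_dividend)
  also have "\<dots> \<le> r * (3 * (k + 4))" using assms(2) by (cases r) auto
  also have "\<dots> \<le> 2 ^ (r * (3 * (k + 4)))" by (rule less_imp_le[OF less_exp])
  finally have "?P (3 * (k + 4) + 1)" unfolding add_diff_cancel_right' by simp
  then have m_spec: "?P m" unfolding assms(4) by (rule LeastI)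
  then obtain s where m_eq: "m = 3 * s + 1" by (metis dvdE le_add_diff_inverse2)
  have char2: "CHAR('a) = 2" by (rule CHAR_eq_prime_if_card_eq_power[OF two_is_prime_nat assms(6)])
  have grouping: "valid_grouping k r 4 (\<lambda>i. i div r)" by (rule valid_grouping_div[OF assms(2,3)])
  have "r + 7 * (r * s) \<le> t" by (simp add: assms(5) m_eq algebra_simps)
  then have "2 ^ (r + 7 * (r * s)) \<le> card (UNIV :: 'a set)" by (simp add: assms(6))
  moreover have "(k + 4) div r \<le> 2 ^ (3 * (r * s))"
    using m_spec by (simp add: m_eq mult.left_commute)
  ultimately obtain \<alpha> :: "nat \<Rightarrow> 'a"
    where points: "field_endomorphism.independent_points (\<lambda>x. x ^ 2) k r 4 (\<lambda>i. i div r) \<alpha>"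
      "\<And>i. k + 4 \<le> i \<Longrightarrow> \<alpha> i = 0"
    using ex_independent_points[OF char2 grouping order.refl dvd_triv_left] by blast
  then show ?thesis
    using ex_maximally_recoverable[OF field_endomorphism_square[OF char2] char2 assms(1) grouping]
      grouping by blast
qed

end
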